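(* Consider a GePUP-ES-RK scheme (described in the context) whose Runge–Kutta method $(A,\mathbf{b},\mathbf{c})$ is algebraically stable, and assume all stage and step quantities exist and are sufficiently smooth. Suppose the body force is conservative, i.e. each $\mathbf{g}^{(i)}$ is the gradient of a scalar field in $\Omega$, and the initial data satisfy $\mathbf{w}^0(\mathbf{x})=\mathbf{u}^0(\mathbf{x})$ for all $\mathbf{x}\in\overline{\Omega}$, where $\mathbf{u}^0$ is divergence-free with $\mathbf{u}^0=\mathbf{0}$ on $\partial\Omega$. Define the modified energy $\mathcal{E}(t^n):=\frac12(\|\mathbf{u}^n\|^2+|r^n|^2)$. Then for every $n$, $$\mathcal{E}(t^{n+1})-\mathcal{E}(t^n)\le-k\nu\sum_{i=1}^sb_i\|\nabla\mathbf{u}^{(i)}\|^2,$$ where $\|\nabla\mathbf{u}\|^2=\sum_{i,j=1}^D\int_\Omega|\partial u_i/\partial x_j|^2\,\mathrm{d}V$.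
   Context: $\Omega\subset\mathbb{R}^D$ is a bounded connected open set with sufficiently smooth boundary, unit outward normal $\mathbf{n}$, unit tangent vector(s) $\boldsymbol{\tau}$; $\|\cdot\|$ is the $L^2(\Omega)$ norm. $\nu>0$, $\lambda\ge0$, time step $k>0$, $t^{n+1}=t^n+k$. The Leray–Helmholtz projection $\mathscr{P}$ maps a $C^1$ field $\mathbf{v}^*$ to $\mathbf{v}^*-\nabla\phi$ with $\Delta\phi=\nabla\cdot\mathbf{v}^*$ in $\Omega$, $\mathbf{n}\cdot\nabla\phi=\mathbf{n}\cdot\mathbf{v}^*$ on $\partial\Omega$. $I_{cv}(\mathbf{u},\mathbf{v}):=\int_\Omega(\mathbf{u}\cdot\nabla\mathbf{u})\cdot\mathbf{v}\,\mathrm{d}V$. An $s$-stage RK method $(A=(a_{i,j}),\mathbf{b},\mathbf{c})$ is algebraically stable if $b_i\ge0$ for all $i$ and the symmetric matrix $M$ with $m_{i,j}=b_ia_{i,j}+b_ja_{j,i}-b_ib_j$ is positive semidefinite. A GePUP-ES-RK scheme: given $\mathbf{w}^n$, $r^n$, forcing approximations $\mathbf{g}^{(i)}$ and given explicit velocity approximations $\widetilde{\mathbf{u}}^{(i)}$ ($i=1,\dots,s$), the stage quantities satisfy for each $i$: $\Delta q^{(i)}=\nabla\cdot(\mathbf{g}^{(i)}-r^{(i)}\widetilde{\mathbf{u}}^{(i)}\cdot\nabla\widetilde{\mathbf{u}}^{(i)})$ in $\Omega$; $\mathbf{n}\cdot\nabla q^{(i)}=\mathbf{n}\cdot(\mathbf{g}^{(i)}-r^{(i)}\widetilde{\mathbf{u}}^{(i)}\cdot\nabla\widetilde{\mathbf{u}}^{(i)}+\nu\Delta\mathbf{w}^{(i)})+\lambda\,\mathbf{n}\cdot\mathbf{w}^{(i)}$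 on $\partial\Omega$; $\boldsymbol{\rho}^{(i)}:=\mathbf{g}^{(i)}-r^{(i)}\widetilde{\mathbf{u}}^{(i)}\cdot\nabla\widetilde{\mathbf{u}}^{(i)}-\nabla q^{(i)}+\nu\Delta\mathbf{w}^{(i)}$; $\mathbf{w}^{(i)}=\mathbf{w}^n+k\sum_{j=1}^sa_{i,j}\boldsymbol{\rho}^{(j)}$ in $\Omega$; $\mathbf{w}^{(i)}\cdot\boldsymbol{\tau}=0$, $\nabla\cdot\mathbf{w}^{(i)}=0$ on $\partial\Omega$; $r^{(i)}=r^n+k\sum_{j=1}^sa_{i,j}I_{cv}(\widetilde{\mathbf{u}}^{(j)},\mathbf{u}^{(j)})$; $\mathbf{u}^{(i)}=\mathscr{P}\mathbf{w}^{(i)}$ in $\Omega$, $\mathbf{n}\cdot\mathbf{u}^{(i)}=0$ on $\partial\Omega$; and the step update is $\mathbf{w}^{n+1}=\mathbf{w}^n+k\sum_{i=1}^sb_i\boldsymbol{\rho}^{(i)}$, $r^{n+1}=r^n+k\sum_{i=1}^sb_iI_{cv}(\widetilde{\mathbf{u}}^{(i)},\mathbf{u}^{(i)})$, $\mathbf{u}^{n+1}=\mathscr{P}\mathbf{w}^{n+1}$ in $\Omega$ with $\mathbf{n}\cdot\mathbf{u}^{n+1}=0$ on $\partial\Omega$. *)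

theory Defs
  imports "HOL-Analysis.Analysis"
begin

definition pd :: "'n::finite \<Rightarrow> (real^'n \<Rightarrow> 'b::real_normed_vector) \<Rightarrow> real^'n \<Rightarrow> 'b" where
  "pd j f x = frechet_derivative f (at x) (axis j 1)"

fun Ck :: "nat \<Rightarrow> (real^'n::finite) set \<Rightarrow> (real^'n \<Rightarrow> 'b::real_normed_vector) \<Rightarrow> bool" where
  "Ck 0 S f = continuous_on S f"
| "Ck (Suc m) S f = (continuous_on S f \<and> (\<forall>x\<in>S. f differentiable (at x)) \<and> (\<forall>j. Ck m S (pd j f)))"

definition smooth_on :: "(real^'n::finite) set \<Rightarrow> (real^'n \<Rightarrow> 'b::real_normed_vector) \<Rightarrow> bool" where
  "smooth_on S f = (\<forall>m. Ck m S f)"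

definition grad :: "(real^'n::finite \<Rightarrow> real) \<Rightarrow> real^'n \<Rightarrow> real^'n" where
  "grad f x = (\<chi> j. pd j f x)"

definition dvg :: "(real^'n::finite \<Rightarrow> real^'n) \<Rightarrow> real^'n \<Rightarrow> real" where
  "dvg v x = (\<Sum>j\<in>UNIV. pd j (\<lambda>y. v y $ j) x)"

definition lap :: "(real^'n::finite \<Rightarrow> 'b::real_normed_vector) \<Rightarrow> real^'n \<Rightarrow> 'b" where
  "lap f x = (\<Sum>j\<in>UNIV. pd j (pd j f) x)"

definition conv :: "(real^'n::finite \<Rightarrow> real^'n) \<Rightarrow> (real^'n \<Rightarrow> real^'n) \<Rightarrow> real^'n \<Rightarrow> real^'n" where
  "conv u v x = (\<Sum>j\<in>UNIV. (u x $ j) *\<^sub>R pd j v x)"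

definition L2sq :: "(real^'n::finite) set \<Rightarrow> (real^'n \<Rightarrow> real^'n) \<Rightarrow> real" where
  "L2sq \<Omega> u = integral \<Omega> (\<lambda>x. (norm (u x))\<^sup>2)"

definition gradL2sq :: "(real^'n::finite) set \<Rightarrow> (real^'n \<Rightarrow> real^'n) \<Rightarrow> real" where
  "gradL2sq \<Omega> u = (\<Sum>j\<in>UNIV. integral \<Omega> (\<lambda>x. (norm (pd j u x))\<^sup>2))"

definition Icv :: "(real^'n::finite) set \<Rightarrow> (real^'n \<Rightarrow> real^'n) \<Rightarrow> (real^'n \<Rightarrow> real^'n) \<Rightarrow> real" where
  "Icv \<Omega> u v = integral \<Omega> (\<lambda>x. conv u u x \<bullet> v x)"

text \<open>Bounded connected open set with smooth boundary, given by a smooth global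
  defining function rho: Omega = {rho < 0}, grad rho nonzero on {rho = 0}.
  The unit outward normal is then grad rho / |grad rho|.\<close>
definition smooth_domain :: "(real^'n::finite) set \<Rightarrow> (real^'n \<Rightarrow> real) \<Rightarrow> bool" where
  "smooth_domain \<Omega> \<rho> = (bounded \<Omega> \<and> connected \<Omega> \<and> open \<Omega> \<and> smooth_on UNIV \<rho> \<and>
      \<Omega> = {x. \<rho> x < 0} \<and> (\<forall>x. \<rho> x = 0 \<longrightarrow> grad \<rho> x \<noteq> 0))"

definition normal :: "(real^'n::finite \<Rightarrow> real) \<Rightarrow> real^'n \<Rightarrow> real^'n" where
  "normal \<rho> x = (1 / norm (grad \<rho> x)) *\<^sub>R grad \<rho> x"

definition leray :: "(real^'n::finite) set \<Rightarrow> (real^'n \<Rightarrow> real^'n) \<Rightarrow> (real^'n \<Rightarrow> real^'n)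
    \<Rightarrow> (real^'n \<Rightarrow> real^'n) \<Rightarrow> bool" where
  "leray \<Omega> nrm v u = (\<exists>\<phi>. smooth_on UNIV \<phi> \<and>
      (\<forall>x\<in>\<Omega>. lap \<phi> x = dvg v x) \<and>
      (\<forall>x\<in>frontier \<Omega>. nrm x \<bullet> grad \<phi> x = nrm x \<bullet> v x) \<and>
      (\<forall>x\<in>\<Omega>. u x = v x - grad \<phi> x) \<and>
      (\<forall>x\<in>frontier \<Omega>. nrm x \<bullet> u x = 0))"

definition alg_stable :: "nat \<Rightarrow> (nat \<Rightarrow> nat \<Rightarrow> real) \<Rightarrow> (nat \<Rightarrow> real) \<Rightarrow> bool" where
  "alg_stable s A b = ((\<forall>i\<in>{1..s}. b i \<ge> 0) \<and>
     (\<forall>\<xi>::nat \<Rightarrow> real. 0 \<le> (\<Sum>i=1..s. \<Sum>j=1..s.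
         (b i * A i j + b j * A j i - b i * b j) * \<xi> i * \<xi> j)))"

end

theory Submission
  imports Defs
begin

text \<open>The Leray projection turns out to act trivially on all stages that matter. Suppose \<open>w n\<close> is
  divergence-free and tangential. Then the divergences \<open>D i\<close> of the stages \<open>W n i\<close> satisfy
  \<open>D i = k * \<nu> * (\<Sum>j. A i j * lap (D j))\<close> in the domain and vanish on the boundary, while their
  normal components \<open>N i\<close> satisfy \<open>N i = - k * lam * (\<Sum>j. A i j * N j)\<close> on the boundary. Algebraic
  stability makes the quadratic form with coefficients \<open>b i * A i j\<close> nonnegative, so that the
  sum of \<open>b i * \<parallel>grad (D i)\<parallel>\<^sup>2\<close> and the sum of \<open>lam * b i * (N i)\<^sup>2\<close> are both at most zero. Hence each
  stage with \<open>b i > 0\<close> is divergence-free, vanishes on the boundary and equals its projection,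
  and \<open>w (Suc n)\<close> is again divergence-free and tangential.

  So \<open>u\<close> itself is advanced by the Runge-Kutta method, and algebraic stability, applied pointwise,
  bounds the increment of \<open>\<parallel>u\<parallel>\<^sup>2 + r\<^sup>2\<close> by twice \<open>k\<close> times the \<open>b\<close>-weighted sum of
  \<open>\<langle>U, Rho\<rangle> + R * Icv\<close> over the stages. There the convection terms cancel, gradients are
  orthogonal to \<open>U\<close>, and the Laplacian gives the dissipation.\<close>

subsection \<open>Partial derivatives of smooth functions\<close>

lemma pd_eq: "(f has_derivative f') (at x) \<Longrightarrow> pd j f x = f' (axis j 1)"
  unfolding pd_def by (metis frechet_derivative_at)

text \<open>Both functions have the same candidate derivatives at \<open>x\<close>, so the choice
  operator behind \<open>frechet_derivative\<close> picks the same one. This covers points where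
  neither is differentiable.\<close>

lemma pd_cong_open:
  assumes "open S" "x \<in> S" "\<And>y. y \<in> S \<Longrightarrow> f y = g y"
  shows "pd j f x = pd j g x"
proof -
  have "(f has_derivative D) (at x) \<longleftrightarrow> (g has_derivative D) (at x)" for D
    using has_derivative_transform_within_open[of f D x UNIV S g]
      has_derivative_transform_within_open[of g D x UNIV S f] assms by auto
  then show ?thesis
    unfolding pd_def frechet_derivative_def by simp
qed

text \<open>Reduces partial derivatives to calculus in one variable, so that the mean value theorem
  applies along coordinate lines.\<close>

lemma pd_along_line:
  assumes "f differentiable (at (x + t *\<^sub>R axis j 1))"
  shows "((\<lambda>t. f (x + t *\<^sub>R axis j 1)) has_vector_derivative pd j f (x + t *\<^sub>R axis j 1)) (at t within S)"
proof -
  let ?D = "frechet_derivative f (at (x + t *\<^sub>R axis j 1))"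
  have "(f has_derivative ?D) (at (x + t *\<^sub>R axis j 1))"
    using assms frechet_derivative_works by blast
  moreover from this have "linear ?D"
    by (rule has_derivative_linear)
  moreover have "((\<lambda>t. x + t *\<^sub>R axis j 1) has_derivative (\<lambda>h. h *\<^sub>R axis j 1)) (at t within S)"
    by (auto intro!: derivative_eq_intros)
  ultimately have "((\<lambda>t. f (x + t *\<^sub>R axis j 1)) has_derivative (\<lambda>h. ?D (h *\<^sub>R axis j 1))) (at t within S)"
    using has_derivative_compose by blast
  with \<open>linear ?D\<close> show ?thesis
    by (simp add: has_vector_derivative_def pd_def linear_cmul)
qed

lemma pd_const [simp]: "pd j (\<lambda>x. c) = (\<lambda>x. 0)"
  by (rule ext) (simp add: pd_eq[OF has_derivative_const])

lemma pd_ident [simp]: "pd j (\<lambda>x. x) = (\<lambda>x. axis j 1)"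
  by (rule ext) (simp add: pd_eq[OF has_derivative_ident])

lemma pd_linear:
  assumes "bounded_linear T" "f differentiable (at x)"
  shows "pd j (\<lambda>y. T (f y)) x = T (pd j f x)"
proof -
  have "(f has_derivative frechet_derivative f (at x)) (at x)"
    using assms(2) frechet_derivative_works by blast
  from bounded_linear.has_derivative[OF assms(1) this] show ?thesis
    by (subst pd_eq) (auto simp: pd_def)
qed

lemma pd_bilinear:
  assumes "bounded_bilinear B" "f differentiable (at x)" "g differentiable (at x)"
  shows "pd j (\<lambda>y. B (f y) (g y)) x = B (f x) (pd j g x) + B (pd j f x) (g x)"
proof -
  have "(f has_derivative frechet_derivative f (at x)) (at x)"
       "(g has_derivative frechet_derivative g (at x)) (at x)"
    using assms(2,3) frechet_derivative_works by blast+
  from bounded_bilinear.FDERIV[OF assms(1) this] show ?thesis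
    by (subst pd_eq) (auto simp: pd_def)
qed

lemma pd_add:
  assumes "f differentiable (at x)" "g differentiable (at x)"
  shows "pd j (\<lambda>y. f y + g y) x = pd j f x + pd j g x"
proof -
  have "(f has_derivative frechet_derivative f (at x)) (at x)"
       "(g has_derivative frechet_derivative g (at x)) (at x)"
    using assms frechet_derivative_works by blast+
  from has_derivative_add[OF this] show ?thesis
    by (subst pd_eq) (auto simp: pd_def)
qed

lemma pd_sum:
  assumes "\<And>i. i \<in> I \<Longrightarrow> f i differentiable (at x)"
  shows "pd j (\<lambda>y. \<Sum>i\<in>I. f i y) x = (\<Sum>i\<in>I. pd j (f i) x)"
proof -
  have "((\<lambda>y. \<Sum>i\<in>I. f i y) has_derivative (\<lambda>h. \<Sum>i\<in>I. frechet_derivative (f i) (at x) h)) (at x)"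
    by (intro has_derivative_sum) (use assms frechet_derivative_works in blast)
  then show ?thesis
    by (subst pd_eq) (auto simp: pd_def)
qed

section \<open>Closure properties of \<open>Ck\<close> and of smooth functions\<close>

lemma Ck_continuous: "Ck m S f \<Longrightarrow> continuous_on S f"
  by (cases m) auto

lemma Ck_SucD: "Ck (Suc m) S f \<Longrightarrow> Ck m S f"
proof (induction m arbitrary: f)
  case (Suc m)
  have "continuous_on S f" "\<forall>x\<in>S. f differentiable (at x)" "\<forall>j. Ck (Suc m) S (pd j f)"
    using Suc.prems unfolding Ck.simps(2)[of "Suc m"] by blast+
  with Suc.IH show ?case
    unfolding Ck.simps(2)[of m S f] by blast
qed auto

lemma Ck_const: "Ck m UNIV (\<lambda>x. c)"
  by (induction m arbitrary: c) auto

lemma Ck_linear: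
  assumes T: "bounded_linear T"
  shows "Ck m UNIV f \<Longrightarrow> Ck m UNIV (\<lambda>x. T (f x))"
proof (induction m arbitrary: f)
  case 0
  then show ?case
    by (auto intro: bounded_linear.continuous_on[OF T])
next
  case (Suc m)
  then have "pd j (\<lambda>x. T (f x)) = (\<lambda>x. T (pd j f x))" for j
    by (intro ext pd_linear[OF T]) auto
  moreover have "(\<lambda>x. T (f x)) differentiable at x" for x
    proof -
    obtain f' where "(f has_derivative f') (at x)"
      using Suc.prems by (auto simp: differentiable_def)
    then show ?thesis
      by (rule differentiableI[OF bounded_linear.has_derivative[OF T]])
  qed
  ultimately show ?case
    using Suc by (auto intro: bounded_linear.continuous_on[OF T])
qed

lemma Ck_add: "Ck m UNIV f \<Longrightarrow> Ck m UNIV g \<Longrightarrow> Ck m UNIV (\<lambda>x. f x + g x)"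
proof (induction m arbitrary: f g)
  case 0
  then show ?case by (auto intro: continuous_intros)
next
  case (Suc m)
  then have "pd j (\<lambda>x. f x + g x) = (\<lambda>x. pd j f x + pd j g x)" for j
    by (intro ext pd_add) auto
  with Suc show ?case by (auto intro: continuous_intros)
qed

lemma Ck_bilinear:
  assumes P: "bounded_bilinear B"
  shows "Ck m UNIV f \<Longrightarrow> Ck m UNIV g \<Longrightarrow> Ck m UNIV (\<lambda>x. B (f x) (g x))"
proof (induction m arbitrary: f g)
  case 0
  then show ?case by (auto intro: bounded_bilinear.continuous_on[OF P])
next
  case (Suc m)
  then have "pd j (\<lambda>x. B (f x) (g x)) = (\<lambda>x. B (f x) (pd j g x) + B (pd j f x) (g x))" for j
    by (intro ext pd_bilinear[OF P]) auto
  \<comment> \<open>The product rule keeps one undifferentiated factor, so the induction hypothesis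
    is also needed for \<open>f\<close> and \<open>g\<close> themselves at the lower order.\<close>
  moreover have "Ck m UNIV f" "Ck m UNIV g"
    using Suc.prems Ck_SucD by blast+
  moreover have "(\<lambda>x. B (f x) (g x)) differentiable at x" for x
    proof -
    obtain f' g' where "(f has_derivative f') (at x)" "(g has_derivative g') (at x)"
      using Suc.prems unfolding Ck.simps differentiable_def by blast
    then show ?thesis
      by (rule differentiableI[OF bounded_bilinear.FDERIV[OF P]])
  qed
  ultimately show ?case
    using Suc by (auto intro!: Ck_add bounded_bilinear.continuous_on[OF P])
qed

lemma smooth_continuous: "smooth_on UNIV f \<Longrightarrow> continuous_on S f"
  unfolding smooth_on_def by (metis Ck_continuous continuous_on_subset subset_UNIV)

lemma smooth_differentiable: "smooth_on UNIV f \<Longrightarrow> f differentiable (at x)"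
  unfolding smooth_on_def by (metis Ck.simps(2) UNIV_I)

lemma smooth_pd: "smooth_on UNIV f \<Longrightarrow> smooth_on UNIV (pd j f)"
  unfolding smooth_on_def by (metis Ck.simps(2))

lemma smooth_const: "smooth_on UNIV (\<lambda>x. c)"
  by (simp add: smooth_on_def Ck_const)

lemma smooth_ident: "smooth_on UNIV (\<lambda>x. x)"
  unfolding smooth_on_def
proof
  show "Ck m UNIV (\<lambda>x::real^'a. x)" for m
    by (cases m) (auto simp: Ck_const)
qed

lemma smooth_linear: "bounded_linear T \<Longrightarrow> smooth_on UNIV f \<Longrightarrow> smooth_on UNIV (\<lambda>x. T (f x))"
  by (simp add: smooth_on_def Ck_linear)

lemma smooth_add: "smooth_on UNIV f \<Longrightarrow> smooth_on UNIV g \<Longrightarrow> smooth_on UNIV (\<lambda>x. f x + g x)"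
  by (simp add: smooth_on_def Ck_add)

lemma smooth_bilinear:
  "bounded_bilinear B \<Longrightarrow> smooth_on UNIV f \<Longrightarrow> smooth_on UNIV g \<Longrightarrow> smooth_on UNIV (\<lambda>x. B (f x) (g x))"
  by (simp add: smooth_on_def Ck_bilinear)

lemma smooth_minus: "smooth_on UNIV f \<Longrightarrow> smooth_on UNIV g \<Longrightarrow> smooth_on UNIV (\<lambda>x. f x - g x)"
  using smooth_add[OF _ smooth_linear[OF bounded_linear_minus[OF bounded_linear_ident]], of f g]
  by simp

lemma smooth_sum: "(\<And>i. i \<in> I \<Longrightarrow> smooth_on UNIV (f i)) \<Longrightarrow> smooth_on UNIV (\<lambda>x. \<Sum>i\<in>I. f i x)"
  by (induction I rule: infinite_finite_induct) (auto intro: smooth_add smooth_const)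

lemma smooth_nth: "smooth_on UNIV v \<Longrightarrow> smooth_on UNIV (\<lambda>x. v x $ j)"
  by (rule smooth_linear[OF bounded_linear_vec_nth])

section \<open>Gradient, divergence and Laplacian of smooth fields\<close>

lemma grad_nth [simp]: "grad f x $ j = pd j f x"
  by (simp add: grad_def)

lemma dvg_grad: "dvg (grad f) = lap f"
  by (simp add: fun_eq_iff dvg_def lap_def grad_def)

lemma smooth_grad:
  assumes "smooth_on UNIV f"
  shows "smooth_on UNIV (grad f)"
proof -
  \<comment> \<open>Smoothness of a vector field is not defined by components; the expansion in the
    standard basis reduces it to sums and scalar multiples.\<close>
  have "grad f = (\<lambda>x. \<Sum>j\<in>UNIV. pd j f x *\<^sub>R axis j 1)"
    using basis_expansion[of "grad f x" for x] by (simp add: fun_eq_iff scalar_mult_eq_scaleR)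
  then show ?thesis
    by (simp only:) (intro smooth_sum smooth_bilinear[OF bounded_bilinear_scaleR] smooth_pd smooth_const assms)
qed

lemma smooth_dvg: "smooth_on UNIV v \<Longrightarrow> smooth_on UNIV (dvg v)"
  unfolding dvg_def[abs_def] by (intro smooth_sum smooth_pd smooth_nth)

lemma smooth_lap: "smooth_on UNIV f \<Longrightarrow> smooth_on UNIV (lap f)"
  unfolding lap_def[abs_def] by (intro smooth_sum smooth_pd)

lemma smooth_conv: "smooth_on UNIV u \<Longrightarrow> smooth_on UNIV v \<Longrightarrow> smooth_on UNIV (conv u v)"
  unfolding conv_def[abs_def]
  by (intro smooth_sum smooth_bilinear[OF bounded_bilinear_scaleR] smooth_pd smooth_nth)

lemmas smooth_scaleR = smooth_bilinear[OF bounded_bilinear_scaleR]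
lemmas smooth_inner = smooth_bilinear[OF bounded_bilinear_inner]
lemmas smooth_mult = smooth_bilinear[OF bounded_bilinear_mult]

lemmas smooth_intros = smooth_const smooth_ident smooth_add smooth_minus smooth_sum smooth_nth
  smooth_pd smooth_grad smooth_dvg smooth_lap smooth_conv smooth_scaleR smooth_inner smooth_mult

lemma pd_nth: "v differentiable (at x) \<Longrightarrow> pd j (\<lambda>y. v y $ i) x = pd j v x $ i"
  by (rule pd_linear[OF bounded_linear_vec_nth])

lemma lap_nth:
  assumes "smooth_on UNIV v"
  shows "lap (\<lambda>y. v y $ i) x = lap v x $ i"
proof -
  have "pd j (\<lambda>y. v y $ i) = (\<lambda>y. pd j v y $ i)" for j
    using assms by (auto simp: pd_nth smooth_differentiable)
  then show ?thesis
    using assms by (simp add: lap_def pd_nth smooth_differentiable smooth_pd)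
qed

text \<open>The mean value theorem is applied first in direction \<open>i\<close>, to a difference
  of two translates of \<open>f\<close>, and then in direction \<open>j\<close>. The left side is
  symmetric in \<open>i\<close> and \<open>j\<close>, while the right side singles out one order of
  differentiation.\<close>

lemma second_difference_mvt:
  fixes f :: "real^'n::finite \<Rightarrow> real"
  assumes "smooth_on UNIV f" and h: "h > 0"
  obtains p q where "0 < p" "p < h" "0 < q" "q < h"
    "f (x + h *\<^sub>R axis i 1 + h *\<^sub>R axis j 1) - f (x + h *\<^sub>R axis i 1) - f (x + h *\<^sub>R axis j 1) + f x
      = h * h * pd j (pd i f) (x + p *\<^sub>R axis i 1 + q *\<^sub>R axis j 1)"
proof -
  let ?ei = "axis i 1 :: real^'n" and ?ej = "axis j 1 :: real^'n"
  have d: "((\<lambda>t. g (y + t *\<^sub>R axis l 1)) has_real_derivative pd l g (y + t *\<^sub>R axis l 1)) (at t)"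
    if "smooth_on UNIV g" for g :: "real^'n \<Rightarrow> real" and y l t
    using pd_along_line[of g y t l UNIV] that smooth_differentiable
    by (auto simp: has_real_derivative_iff_has_vector_derivative)
  have "((\<lambda>t. f ((x + h *\<^sub>R ?ej) + t *\<^sub>R ?ei) - f (x + t *\<^sub>R ?ei)) has_real_derivative
      pd i f ((x + h *\<^sub>R ?ej) + t *\<^sub>R ?ei) - pd i f (x + t *\<^sub>R ?ei)) (at t)" for t
    by (intro DERIV_diff d assms)
  from MVT2[OF h this] obtain p where p: "0 < p" "p < h"
    "f ((x + h *\<^sub>R ?ej) + h *\<^sub>R ?ei) - f (x + h *\<^sub>R ?ei) - (f (x + h *\<^sub>R ?ej) - f x)
      = h * (pd i f ((x + h *\<^sub>R ?ej) + p *\<^sub>R ?ei) - pd i f (x + p *\<^sub>R ?ei))"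
    by auto
  have "((\<lambda>t. pd i f ((x + p *\<^sub>R ?ei) + t *\<^sub>R ?ej)) has_real_derivative
      pd j (pd i f) ((x + p *\<^sub>R ?ei) + t *\<^sub>R ?ej)) (at t)" for t
    by (intro d smooth_pd assms)
  from MVT2[OF h this] obtain q where q: "0 < q" "q < h"
    "pd i f ((x + p *\<^sub>R ?ei) + h *\<^sub>R ?ej) - pd i f (x + p *\<^sub>R ?ei)
      = h * pd j (pd i f) ((x + p *\<^sub>R ?ei) + q *\<^sub>R ?ej)"
    by auto
  show thesis
    by (rule that[of p q]) (use p q in \<open>simp_all add: algebra_simps\<close>)
qed

text \<open>The second difference equals \<open>h * h\<close> times either mixed partial at some
  point near \<open>x\<close>. Both therefore share a value at arbitrarily close points, and
  continuity forces equality at \<open>x\<close>.\<close>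

lemma mixed_partials:
  fixes f :: "real^'n::finite \<Rightarrow> real"
  assumes f: "smooth_on UNIV f"
  shows "pd j (pd i f) x = pd i (pd j f) x"
proof (rule ccontr)
  let ?a = "pd j (pd i f)" and ?b = "pd i (pd j f)"
  assume neq: "?a x \<noteq> ?b x"
  define e where "e = \<bar>?a x - ?b x\<bar> / 2"
  have e: "e > 0" using neq by (simp add: e_def)
  have "continuous_on UNIV ?a" "continuous_on UNIV ?b"
    by (intro smooth_continuous smooth_pd f)+
  then obtain d1 d2 where d: "d1 > 0" "d2 > 0"
    "\<And>y. dist y x < d1 \<Longrightarrow> dist (?a y) (?a x) < e"
    "\<And>y. dist y x < d2 \<Longrightarrow> dist (?b y) (?b x) < e"
    using e unfolding continuous_on_iff by (metis UNIV_I)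
  \<comment> \<open>The evaluation points are displaced by less than \<open>h\<close> along each of
    two axes, hence by less than \<open>2 * h\<close> in total.\<close>
  define h where "h = min d1 d2 / 2"
  have h: "h > 0" using d by (simp add: h_def)
  have near: "dist (x + p *\<^sub>R axis k 1 + q *\<^sub>R axis l 1) x < min d1 d2"
    if "0 < p" "p < h" "0 < q" "q < h" for p q and k l :: 'n
  proof -
    have "norm (p *\<^sub>R axis k (1::real) + q *\<^sub>R axis l 1) \<le> p + q"
      using that by (intro norm_triangle_le) (auto simp: norm_axis_1)
    then show ?thesis using that by (simp add: dist_norm h_def add.assoc)
  qed
  obtain p q where pq: "0 < p" "p < h" "0 < q" "q < h"
    "f (x + h *\<^sub>R axis i 1 + h *\<^sub>R axis j 1) - f (x + h *\<^sub>R axis i 1) - f (x + h *\<^sub>R axis j 1) + f x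
      = h * h * ?a (x + p *\<^sub>R axis i 1 + q *\<^sub>R axis j 1)"
    using second_difference_mvt[OF f h] by metis
  obtain p' q' where pq': "0 < p'" "p' < h" "0 < q'" "q' < h"
    "f (x + h *\<^sub>R axis j 1 + h *\<^sub>R axis i 1) - f (x + h *\<^sub>R axis j 1) - f (x + h *\<^sub>R axis i 1) + f x
      = h * h * ?b (x + p' *\<^sub>R axis j 1 + q' *\<^sub>R axis i 1)"
    using second_difference_mvt[OF f h] by metis
  have "h * h * ?a (x + p *\<^sub>R axis i 1 + q *\<^sub>R axis j 1) = h * h * ?b (x + p' *\<^sub>R axis j 1 + q' *\<^sub>R axis i 1)"
    unfolding pq(5)[symmetric] pq'(5)[symmetric] by (simp add: algebra_simps)
  then have "?a (x + p *\<^sub>R axis i 1 + q *\<^sub>R axis j 1) = ?b (x + p' *\<^sub>R axis j 1 + q' *\<^sub>R axis i 1)"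
    using h by simp
  moreover have "\<bar>?a (x + p *\<^sub>R axis i 1 + q *\<^sub>R axis j 1) - ?a x\<bar> < e"
    using d(3) near[OF pq(1-4), of i j] by (simp add: dist_real_def)
  moreover have "\<bar>?b (x + p' *\<^sub>R axis j 1 + q' *\<^sub>R axis i 1) - ?b x\<bar> < e"
    using d(4) near[OF pq'(1-4), of j i] by (simp add: dist_real_def)
  ultimately have "\<bar>?a x - ?b x\<bar> < 2 * e"
    by linarith
  then show False
    by (simp add: e_def)
qed

text \<open>Two exchanges of partial derivatives move the outer one inside. This turns the
  divergence of the viscous term into an expression in the divergence alone.\<close>

lemma dvg_lap:
  assumes v: "smooth_on UNIV v"
  shows "dvg (lap v) x = lap (dvg v) x"
proof -
  have "dvg (lap v) x = (\<Sum>j\<in>UNIV. pd j (\<lambda>y. lap (\<lambda>z. v z $ j) y) x)"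
    by (simp add: dvg_def lap_nth[OF v])
  also have "\<dots> = (\<Sum>j\<in>UNIV. \<Sum>i\<in>UNIV. pd j (pd i (pd i (\<lambda>z. v z $ j))) x)"
    unfolding lap_def by (intro sum.cong refl pd_sum smooth_differentiable smooth_intros v)
  also have "\<dots> = (\<Sum>j\<in>UNIV. \<Sum>i\<in>UNIV. pd i (pd i (pd j (\<lambda>z. v z $ j))) x)"
  proof (intro sum.cong refl)
    fix i j
    have "pd j (pd i (\<lambda>z. v z $ j)) = pd i (pd j (\<lambda>z. v z $ j))"
      by (intro ext mixed_partials smooth_intros v)
    then show "pd j (pd i (pd i (\<lambda>z. v z $ j))) x = pd i (pd i (pd j (\<lambda>z. v z $ j))) x"
      by (subst mixed_partials) (simp_all add: smooth_pd smooth_nth v)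
  qed
  also have "\<dots> = (\<Sum>i\<in>UNIV. \<Sum>j\<in>UNIV. pd i (pd i (pd j (\<lambda>z. v z $ j))) x)"
    by (rule sum.swap)
  also have "\<dots> = (\<Sum>i\<in>UNIV. pd i (pd i (dvg v)) x)"
  proof (intro sum.cong refl)
    fix i
    have "pd i (dvg v) = (\<lambda>x. \<Sum>j\<in>UNIV. pd i (pd j (\<lambda>z. v z $ j)) x)"
      unfolding dvg_def[abs_def]
      by (intro ext pd_sum smooth_differentiable smooth_intros v)
    then show "(\<Sum>j\<in>UNIV. pd i (pd i (pd j (\<lambda>z. v z $ j))) x) = pd i (pd i (dvg v)) x"
      by (simp add: pd_sum smooth_differentiable smooth_pd smooth_nth v)
  qed
  finally show ?thesis by (simp add: lap_def)
qed

subsection \<open>The divergence theorem for tangential fields\<close>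

text \<open>Integrability is inherited from an enclosing compact box, which is why continuity is
  asked on the whole space and not just on the open set.\<close>

lemma continuous_integrable_bounded_open:
  fixes f :: "'a::euclidean_space \<Rightarrow> 'b::euclidean_space"
  assumes "bounded \<Omega>" "open \<Omega>" "continuous_on UNIV f"
  shows "f integrable_on \<Omega>"
proof -
  obtain a where a: "\<Omega> \<subseteq> cbox (- a) a"
    using bounded_subset_cbox_symmetric[OF assms(1)] by metis
  have "set_integrable lborel (cbox (- a) a) f"
    unfolding set_integrable_def
    by (intro borel_integrable_compact continuous_on_subset[OF assms(3)]) auto
  then have "set_integrable lborel \<Omega> f"
    using a assms(2) by (rule_tac set_integrable_subset) auto
  then show ?thesis
    by (rule set_borel_integral_eq_integral)
qed

text \<open>Differentiates the translation invariant integral of \<open>f\<close> under the integral sign, so no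
  iterated integrals are needed.\<close>

lemma integral_pd_compact_support:
  fixes f :: "real^'n::finite \<Rightarrow> real"
  assumes diff: "\<And>x. f differentiable (at x)"
    and cont: "continuous_on UNIV (pd j f)"
    and "bounded S" and supp: "\<And>x. x \<notin> S \<Longrightarrow> f x = 0"
  shows "integrable lborel (pd j f)" "integral UNIV (pd j f) = 0"
proof -
  obtain M where M: "M > 0" "\<And>x. x \<in> S \<Longrightarrow> norm x \<le> M"
    using \<open>bounded S\<close> unfolding bounded_pos by blast
  have f0: "f x = 0" if "norm x > M" for x
    using supp M(2)[of x] that by fastforce
  have d0: "pd j f x = 0" if "norm x > M" for x
  proof -
    have "open (- cball (0::real^'n) M)" by (simp add: open_Compl)
    from pd_cong_open[OF this, of x f "\<lambda>_. 0" j] show ?thesis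
      using f0 that by auto
  qed
  have "compact (pd j f ` cball 0 M)"
    by (intro compact_continuous_image continuous_on_subset[OF cont]) auto
  then obtain B where B: "B > 0" "\<And>x. x \<in> cball 0 M \<Longrightarrow> \<bar>pd j f x\<bar> \<le> B"
    using compact_imp_bounded bounded_pos by (metis imageI real_norm_def)
  have B': "\<bar>pd j f x\<bar> \<le> B" for x
    using B d0[of x] by (cases "norm x \<le> M") auto
  have fcont: "continuous_on UNIV f"
    using diff by (simp add: continuous_on_eq_continuous_within differentiable_imp_continuous_within)
  have supp_eq: "g = (\<lambda>x. indicator (cball 0 M) x *\<^sub>R g x)"
    if "\<And>x. norm x > M \<Longrightarrow> g x = 0" for g :: "real^'n \<Rightarrow> real"
    using that by (force simp: indicator_def fun_eq_iff not_le)
  have intg: "integrable lborel g"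
    if "\<And>x. norm x > M \<Longrightarrow> g x = 0" "continuous_on UNIV g" for g :: "real^'n \<Rightarrow> real"
  proof -
    have "integrable lborel (\<lambda>x. indicator (cball 0 M) x *\<^sub>R g x)"
      by (intro borel_integrable_compact continuous_on_subset[OF that(2)]) auto
    then show ?thesis
      using supp_eq[of g] that(1) by simp
  qed
  have intf: "integrable lborel f" by (rule intg[OF f0 fcont])
  show intd: "integrable lborel (pd j f)" by (rule intg[OF d0 cont])
  \<comment> \<open>Step lengths of at most 1 keep the support of every difference quotient inside
    the ball of radius \<open>M + 1\<close>.\<close>
  define t where "t n = 1 / real (Suc n)" for n
  have t: "0 < t n" "t n \<le> 1" for n by (auto simp: t_def)
  define q where "q n x = (f (t n *\<^sub>R axis j 1 + x) - f x) / t n" for n x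
  have shift: "integrable lborel (\<lambda>x. f (c + x))" "(\<integral>x. f (c + x) \<partial>lborel) = (\<integral>x. f x \<partial>lborel)" for c
  proof -
    have m: "f \<in> borel_measurable borel"
      using fcont by (rule borel_measurable_continuous_onI)
    show "integrable lborel (\<lambda>x. f (c + x))"
      using integrable_distr_eq[of "(+) c" lborel borel f] m intf by (simp add: lborel_distr_plus)
    show "(\<integral>x. f (c + x) \<partial>lborel) = (\<integral>x. f x \<partial>lborel)"
      using integral_distr[of "(+) c" lborel borel f] m by (simp add: lborel_distr_plus)
  qed
  have q0: "(\<integral>x. q n x \<partial>lborel) = 0" for n
    unfolding q_def using shift intf by simp
  have line: "((\<lambda>s. f (x + s *\<^sub>R axis j 1)) has_real_derivative pd j f (x + s *\<^sub>R axis j 1)) (at s)" for x s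
    using pd_along_line[OF diff] by (simp add: has_real_derivative_iff_has_vector_derivative)
  \<comment> \<open>By the mean value theorem each quotient is a value of the derivative. Together
    with the common support this gives the dominating function.\<close>
  have qB: "\<bar>q n x\<bar> \<le> B" for n x
  proof -
    obtain z where "f (x + t n *\<^sub>R axis j 1) - f (x + 0 *\<^sub>R axis j 1)
        = (t n - 0) * pd j f (x + z *\<^sub>R axis j 1)"
      using MVT2[OF t(1) line, of n x] by blast
    then have "q n x = pd j f (x + z *\<^sub>R axis j 1)"
      using t(1)[of n] by (simp add: q_def add.commute)
    then show ?thesis using B' by simp
  qed
  have qsupp: "q n x = 0" if "norm x > M + 1" for n x
  proof -
    have "norm x \<le> norm (t n *\<^sub>R axis j 1 + x) + norm (t n *\<^sub>R axis j (1::real))"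
      by (metis add_diff_cancel_left' norm_triangle_sub add.commute norm_minus_commute)
    then have "norm (t n *\<^sub>R axis j 1 + x) > M"
      using that t[of n] by simp
    then show ?thesis using f0 that by (simp add: q_def)
  qed
  have "(\<lambda>n. \<integral>x. q n x \<partial>lborel) \<longlonglongrightarrow> (\<integral>x. pd j f x \<partial>lborel)"
  proof (rule integral_dominated_convergence)
    show "integrable lborel (\<lambda>x. indicator (cball 0 (M + 1)) x *\<^sub>R B)"
      by (intro borel_integrable_compact) auto
    show "AE x in lborel. norm (q n x) \<le> indicator (cball 0 (M + 1)) x *\<^sub>R B" for n
      using qB qsupp B(1) by (intro AE_I2) (force simp: indicator_def not_le)
    have "(\<lambda>n. q n x) \<longlonglongrightarrow> pd j f x" for x
    proof -
      have "((\<lambda>h. (f (x + (0 + h) *\<^sub>R axis j 1) - f (x + 0 *\<^sub>R axis j 1)) / h) \<longlongrightarrow> pd j f (x + 0 *\<^sub>R axis j 1)) (at 0)"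
        using line[of x 0] unfolding DERIV_def .
      moreover have "filterlim t (at 0) sequentially"
        unfolding filterlim_at
        using LIMSEQ_inverse_real_of_nat t by (auto simp: t_def[abs_def] inverse_eq_divide)
      ultimately have "(\<lambda>n. (f (x + (0 + t n) *\<^sub>R axis j 1) - f (x + 0 *\<^sub>R axis j 1)) / t n) \<longlonglongrightarrow> pd j f (x + 0 *\<^sub>R axis j 1)"
        by (rule filterlim_compose)
      then show ?thesis by (simp add: q_def add.commute)
    qed
    then show "AE x in lborel. (\<lambda>n. q n x) \<longlonglongrightarrow> pd j f x" by simp
    show "q n \<in> borel_measurable lborel" for n
      unfolding q_def using shift(1) intf by (intro borel_measurable_divide borel_measurable_diff) auto
  qed (use intd in auto)
  then have "(\<integral>x. pd j f x \<partial>lborel) = 0"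
    by (simp add: q0 LIMSEQ_const_iff)
  then show "integral UNIV (pd j f) = 0"
    using integral_lborel[OF intd] by simp
qed

section \<open>A continuously differentiable cut-off function\<close>

lemma DERIV_pos_part_square: "((\<lambda>t::real. (max 0 t)\<^sup>2) has_real_derivative 2 * max 0 t) (at t)"
proof (cases "t = 0")
  case True
  have "((\<lambda>h::real. (max 0 h)\<^sup>2 / h) \<longlongrightarrow> 0) (at 0)"
  proof (rule Lim_null_comparison)
    show "\<forall>\<^sub>F h::real in at 0. norm ((max 0 h)\<^sup>2 / h) \<le> \<bar>h\<bar>"
      by (intro always_eventually) (auto simp: max_def power2_eq_square)
    show "((\<lambda>h::real. \<bar>h\<bar>) \<longlongrightarrow> 0) (at 0)"
      by (intro tendsto_rabs_zero tendsto_ident_at)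
  qed
  with True show ?thesis by (simp add: DERIV_def)
next
  case False
  then consider "t < 0" | "t > 0" by linarith
  then show ?thesis
  proof cases
    case 1
    have "((\<lambda>_. 0) has_real_derivative 2 * max 0 t) (at t)"
      using 1 by (auto simp: max_def)
    then show ?thesis
      by (rule has_field_derivative_transform_within_open[where S="{..<0}"]) (use 1 in auto)
  next
    case 2
    have "((\<lambda>t. t\<^sup>2) has_real_derivative 2 * max 0 t) (at t)"
      using 2 by (auto intro!: derivative_eq_intros simp: max_def)
    then show ?thesis
      by (rule has_field_derivative_transform_within_open[where S="{0<..}"]) (use 2 in auto)
  qed
qed

text \<open>A monotone transition from 0 to 1, equal to the polynomial
  \<open>1 - (1 - t\<^sup>2)\<^sup>2\<close> on the unit interval. Since the square of a positive
  part is continuously differentiable, nesting two of them gives one formula whose derivative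
  follows from the chain rule.\<close>

definition step :: "real \<Rightarrow> real" where
  "step t = 1 - (max 0 (1 - (max 0 t)\<^sup>2))\<^sup>2"

definition step' :: "real \<Rightarrow> real" where
  "step' t = 4 * max 0 (1 - (max 0 t)\<^sup>2) * max 0 t"

lemma DERIV_step: "(step has_real_derivative step' t) (at t)"
proof -
  have "((\<lambda>t. 1 - (max 0 t)\<^sup>2) has_real_derivative 0 - 2 * max 0 t) (at t)"
    by (intro DERIV_diff DERIV_const DERIV_pos_part_square)
  from DERIV_diff[OF DERIV_const[of 1] DERIV_chain2[OF DERIV_pos_part_square this]]
  show ?thesis
    by (simp add: step_def[abs_def] step'_def mult.assoc)
qed

lemma step_nonpos: "t \<le> 0 \<Longrightarrow> step t = 0" "t \<le> 0 \<Longrightarrow> step' t = 0"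
  by (simp_all add: step_def step'_def)

lemma step_ge_1: "t \<ge> 1 \<Longrightarrow> step t = 1" "t \<ge> 1 \<Longrightarrow> step' t = 0"
  by (simp_all add: step_def step'_def max_def power_le_one_iff)

lemma step_bounds: "0 \<le> step t" "step t \<le> 1" "0 \<le> step' t"
  by (simp_all add: step_def step'_def power_le_one)

lemma continuous_on_step [continuous_intros]:
  "continuous_on S f \<Longrightarrow> continuous_on S (\<lambda>x. step (f x))"
  "continuous_on S f \<Longrightarrow> continuous_on S (\<lambda>x. step' (f x))"
  unfolding step_def step'_def by (intro continuous_intros; assumption)+

text \<open>The cut-off vanishes together with its derivative outside the domain, so the cut-off
  field is continuously differentiable on the whole space with bounded support. Its divergence
  integrates to zero, and the product rule splits that integral into the two sides.\<close>

lemma cutoff_divergence: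
  fixes F :: "real^'n::finite \<Rightarrow> real^'n"
  assumes dom: "smooth_domain \<Omega> \<rho>" and F: "smooth_on UNIV F" and e: "e > 0"
  shows "integral \<Omega> (\<lambda>x. step (- \<rho> x / e) * dvg F x)
    = integral \<Omega> (\<lambda>x. step' (- \<rho> x / e) / e * (grad \<rho> x \<bullet> F x))"
proof -
  have \<Omega>: "bounded \<Omega>" "open \<Omega>" "\<Omega> = {x. \<rho> x < 0}" and \<rho>: "smooth_on UNIV \<rho>"
    using dom by (auto simp: smooth_domain_def)
  define c where "c x = step (- \<rho> x / e)" for x
  define g where "g x = c x * dvg F x - step' (- \<rho> x / e) / e * (grad \<rho> x \<bullet> F x)" for x
  have outside: "c x = 0" "step' (- \<rho> x / e) = 0" if "x \<notin> \<Omega>" for x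
    using that e by (auto simp: c_def \<Omega>(3) step_nonpos divide_nonpos_pos)
  have cd: "(c has_derivative (\<lambda>h. step' (- \<rho> x / e) * (- frechet_derivative \<rho> (at x) h / e))) (at x)" for x
  proof -
    have "(\<rho> has_derivative frechet_derivative \<rho> (at x)) (at x)"
      using smooth_differentiable[OF \<rho>] frechet_derivative_works by blast
    then have "((\<lambda>x. - \<rho> x / e) has_derivative (\<lambda>h. - frechet_derivative \<rho> (at x) h / e)) (at x)"
      using e by (auto intro!: derivative_eq_intros)
    then show ?thesis unfolding c_def[abs_def]
      using DERIV_step[of "- \<rho> x / e"] has_derivative_compose
      unfolding has_field_derivative_def by blast
  qed
  have cdiff: "c differentiable (at x)" for x
    using cd differentiable_def by blast
  have pdc: "pd j c x = - step' (- \<rho> x / e) / e * pd j \<rho> x" for j x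
    using pd_eq[OF cd] by (simp add: pd_def)
  define f where "f j x = c x * F x $ j" for j x
  have pdf: "pd j (f j) = (\<lambda>x. c x * pd j (\<lambda>y. F y $ j) x - step' (- \<rho> x / e) / e * (pd j \<rho> x * F x $ j))" for j
    unfolding f_def[abs_def]
    by (rule ext, subst pd_bilinear[OF bounded_bilinear_mult])
      (auto simp: cdiff pdc smooth_differentiable smooth_nth F)
  have c_cont: "continuous_on S c" for S
    unfolding c_def[abs_def] using e by (intro continuous_intros smooth_continuous[OF \<rho>]) auto
  have s'_cont: "continuous_on S (\<lambda>x. step' (- \<rho> x / e) / e)" for S
    using e by (intro continuous_intros smooth_continuous[OF \<rho>]) auto
  have fdiff: "f j differentiable (at x)" for j x
    unfolding f_def[abs_def] by (intro differentiable_mult cdiff smooth_differentiable smooth_nth F)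
  have fcont: "continuous_on UNIV (pd j (f j))" for j
    unfolding pdf by (intro continuous_on_diff continuous_on_mult c_cont s'_cont smooth_continuous smooth_intros F \<rho>)
  have f0: "f j x = 0" if "x \<notin> \<Omega>" for j x
    using outside that by (simp add: f_def)
  note int = integral_pd_compact_support[OF fdiff fcont \<Omega>(1) f0]
  have g_eq: "g x = (\<Sum>j\<in>UNIV. pd j (f j) x)" for x
    by (simp add: g_def pdf dvg_def inner_vec_def sum_subtractf sum_distrib_left)
  have "integral UNIV g = (\<Sum>j\<in>UNIV. integral UNIV (pd j (f j)))"
    unfolding g_eq[abs_def]
    by (intro integral_sum) (use int(1) has_integral_integral_lborel in \<open>auto simp: integrable_on_def\<close>)
  then have "integral UNIV g = 0"
    by (simp add: int(2))
  moreover have "g = (\<lambda>x. if x \<in> \<Omega> then g x else 0)"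
    using outside by (auto simp: g_def fun_eq_iff)
  ultimately have "integral \<Omega> g = 0"
    using integral_restrict_UNIV[of \<Omega> g] by simp
  moreover have "(\<lambda>x. c x * dvg F x) integrable_on \<Omega>"
    by (intro continuous_integrable_bounded_open \<Omega>(1,2) continuous_on_mult c_cont smooth_continuous smooth_intros F)
  moreover have "(\<lambda>x. step' (- \<rho> x / e) / e * (grad \<rho> x \<bullet> F x)) integrable_on \<Omega>"
    by (intro continuous_integrable_bounded_open \<Omega>(1,2) continuous_on_mult s'_cont smooth_continuous smooth_intros F \<rho>)
  ultimately show ?thesis
    unfolding g_def[abs_def] c_def by (simp add: integral_diff)
qed

lemma smooth_domain_frontier:
  assumes "smooth_domain \<Omega> \<rho>"
  shows "x \<in> frontier \<Omega> \<longleftrightarrow> x \<in> closure \<Omega> \<and> \<rho> x = 0"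
proof -
  have \<Omega>: "open \<Omega>" "\<Omega> = {x. \<rho> x < 0}" and \<rho>: "continuous_on UNIV \<rho>"
    using assms by (auto simp: smooth_domain_def smooth_continuous)
  have "closed {x. \<rho> x \<le> 0}"
    by (intro closed_Collect_le \<rho>) auto
  then have "closure \<Omega> \<subseteq> {x. \<rho> x \<le> 0}"
    using \<Omega>(2) by (intro closure_minimal) auto
  then show ?thesis
    using \<Omega> by (force simp: frontier_def interior_open)
qed

text \<open>The cut-off \<open>step (- \<rho> / e)\<close> leaves a boundary
  layer integral of \<open>grad \<rho> \<bullet> F\<close>, which is dominated by \<open>d\<close> times the layer integral of
  \<open>(norm (grad \<rho>))\<^sup>2\<close>. Choosing \<open>F = grad \<rho>\<close> in the cut-off identity bounds the latter by the
  integral of \<open>\<bar>lap \<rho>\<bar>\<close>, so no surface measure and no estimate of the layer's volume is needed.\<close>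

theorem integral_dvg_tangential:
  fixes F :: "real^'n::finite \<Rightarrow> real^'n"
  assumes dom: "smooth_domain \<Omega> \<rho>" and F: "smooth_on UNIV F"
    and tang: "\<And>x. x \<in> frontier \<Omega> \<Longrightarrow> grad \<rho> x \<bullet> F x = 0"
  shows "integral \<Omega> (dvg F) = 0"
proof -
  have \<Omega>: "bounded \<Omega>" "open \<Omega>" "\<Omega> = {x. \<rho> x < 0}" and \<rho>: "smooth_on UNIV \<rho>"
    and nz: "\<And>x. \<rho> x = 0 \<Longrightarrow> grad \<rho> x \<noteq> 0"
    using dom by (auto simp: smooth_domain_def)
  note intg = continuous_integrable_bounded_open[OF \<Omega>(1,2)]
  define C where "C = integral \<Omega> (\<lambda>x. \<bar>lap \<rho> x\<bar>)"
  have C: "C \<ge> 0"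
    unfolding C_def
    by (intro integral_nonneg intg continuous_on_rabs smooth_continuous smooth_lap \<rho>) auto
  have bound: "\<bar>integral \<Omega> (dvg F)\<bar> \<le> d * C" if d: "d > 0" for d
  proof -
    obtain h where h: "h > 0"
      "\<And>x. x \<in> \<Omega> \<Longrightarrow> \<rho> x > - h \<Longrightarrow> \<bar>grad \<rho> x \<bullet> F x\<bar> \<le> d * (grad \<rho> x \<bullet> grad \<rho> x)"
    proof -
      \<comment> \<open>The compact set where the desired estimate fails. It misses the frontier,
        where tangency makes the right side of the inequality zero and the left side positive. So
        the maximum of \<open>\<rho>\<close> on it is negative and gives the thickness
        \<open>h\<close> of a layer free of such points.\<close>
      define K where "K = closure \<Omega> \<inter> {x. d * (grad \<rho> x \<bullet> grad \<rho> x) \<le> \<bar>grad \<rho> x \<bullet> F x\<bar>}"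
      have "closed {x. d * (grad \<rho> x \<bullet> grad \<rho> x) \<le> \<bar>grad \<rho> x \<bullet> F x\<bar>}"
        by (intro closed_Collect_le continuous_on_rabs smooth_continuous smooth_intros \<rho> F)
      then have "compact K"
        using \<Omega>(1) unfolding K_def by (intro compact_Int_closed) (auto simp: compact_closure)
      show thesis
      proof (cases "K = {}")
        case True
        then show ?thesis
          using closure_subset[of \<Omega>] by (intro that[of 1]) (fastforce simp: K_def)+
      next
        case False
        then obtain m where m: "m \<in> K" "\<And>x. x \<in> K \<Longrightarrow> \<rho> x \<le> \<rho> m"
          using continuous_attains_sup[OF \<open>compact K\<close> False smooth_continuous[OF \<rho>]] by blast
        have "m \<notin> frontier \<Omega>"
        proof
          assume "m \<in> frontier \<Omega>"
          then have "grad \<rho> m \<noteq> 0" "grad \<rho> m \<bullet> F m = 0"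
            using nz tang smooth_domain_frontier[OF dom] by auto
          moreover from this have "0 < d * (grad \<rho> m \<bullet> grad \<rho> m)"
            using d by simp
          ultimately show False using m(1) by (simp add: K_def)
        qed
        then have "\<rho> m < 0"
          using m(1) \<Omega> by (auto simp: K_def frontier_def interior_open)
        moreover have "x \<notin> K" if "\<rho> x > \<rho> m" for x
          using m(2)[of x] that by auto
        ultimately show ?thesis
          using closure_subset[of \<Omega>] by (intro that[of "- \<rho> m"]) (fastforce simp: K_def)+
      qed
    qed
    \<comment> \<open>With \<open>e n \<le> h\<close>, the set where \<open>step'\<close> can be
      nonzero lies inside the layer of thickness \<open>h\<close>.\<close>
    define e where "e n = h / real (Suc n)" for n
    have e: "0 < e n" "e n \<le> h" for n
      using h(1) by (auto simp: e_def field_simps)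
    have "\<bar>integral \<Omega> (\<lambda>x. step (- \<rho> x / e n) * dvg F x)\<bar> \<le> d * C" for n
    proof -
      let ?s = "\<lambda>x. step (- \<rho> x / e n)" and ?s' = "\<lambda>x. step' (- \<rho> x / e n) / e n"
      have ie: "(\<lambda>x. f x * g x) integrable_on \<Omega>" 
        if "f = ?s \<or> f = ?s'" "continuous_on UNIV g" for f g :: "real^'n \<Rightarrow> real"
        using that e(1)[of n] by (auto intro!: intg continuous_intros smooth_continuous[OF \<rho>])
      have "\<bar>integral \<Omega> (\<lambda>x. ?s x * dvg F x)\<bar> = \<bar>integral \<Omega> (\<lambda>x. ?s' x * (grad \<rho> x \<bullet> F x))\<bar>"
        using cutoff_divergence[OF dom F e(1)] by simp
      also have "\<dots> \<le> integral \<Omega> (\<lambda>x. d * (?s' x * (grad \<rho> x \<bullet> grad \<rho> x)))"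
      proof (rule integral_norm_bound_integral[where 'a=real, unfolded real_norm_def])
        fix x assume x: "x \<in> \<Omega>"
        show "\<bar>?s' x * (grad \<rho> x \<bullet> F x)\<bar> \<le> d * (?s' x * (grad \<rho> x \<bullet> grad \<rho> x))"
        proof (cases "\<rho> x > - e n")
          case True
          then have "\<bar>grad \<rho> x \<bullet> F x\<bar> \<le> d * (grad \<rho> x \<bullet> grad \<rho> x)"
            using h(2)[OF x] e(2)[of n] by simp
          then have "?s' x * \<bar>grad \<rho> x \<bullet> F x\<bar> \<le> ?s' x * (d * (grad \<rho> x \<bullet> grad \<rho> x))"
            using step_bounds(3) e(1)[of n] by (intro mult_left_mono) auto
          then show ?thesis
            using step_bounds(3)[of "- \<rho> x / e n"] e(1)[of n] by (simp add: abs_mult mult_ac)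
        next
          case False
          then have "step' (- \<rho> x / e n) = 0"
            using e(1)[of n] by (intro step_ge_1) (auto simp: field_simps)
          then show ?thesis by simp
        qed
      next
        show "(\<lambda>x. ?s' x * (grad \<rho> x \<bullet> F x)) integrable_on \<Omega>"
          by (intro ie smooth_continuous smooth_intros \<rho> F) auto
        show "(\<lambda>x. d * (?s' x * (grad \<rho> x \<bullet> grad \<rho> x))) integrable_on \<Omega>"
          by (intro integrable_on_mult_right ie smooth_continuous smooth_intros \<rho>) auto
      qed
      also have "\<dots> = d * integral \<Omega> (\<lambda>x. ?s x * lap \<rho> x)"
        using cutoff_divergence[OF dom smooth_grad[OF \<rho>] e(1)] by (simp add: dvg_grad)
      also have "integral \<Omega> (\<lambda>x. ?s x * lap \<rho> x) \<le> C"
        unfolding C_def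
      proof (rule integral_le)
        show "(\<lambda>x. ?s x * lap \<rho> x) integrable_on \<Omega>"
          by (intro ie smooth_continuous smooth_intros \<rho>) auto
        show "(\<lambda>x. \<bar>lap \<rho> x\<bar>) integrable_on \<Omega>"
          by (intro intg continuous_on_rabs smooth_continuous smooth_lap \<rho>)
        fix x
        have "?s x * lap \<rho> x \<le> ?s x * \<bar>lap \<rho> x\<bar>"
          using step_bounds(1) by (intro mult_left_mono) auto
        also have "\<dots> \<le> 1 * \<bar>lap \<rho> x\<bar>"
          using step_bounds(2) by (intro mult_right_mono) auto
        finally show "?s x * lap \<rho> x \<le> \<bar>lap \<rho> x\<bar>" by simp
      qed
      finally show ?thesis using d by simp
    qed
    moreover have "(\<lambda>n. integral \<Omega> (\<lambda>x. step (- \<rho> x / e n) * dvg F x)) \<longlonglongrightarrow> integral \<Omega> (dvg F)"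
    proof (rule dominated_convergence(2))
      show "(\<lambda>x. step (- \<rho> x / e n) * dvg F x) integrable_on \<Omega>" for n
        using e(1)[of n]
        by (intro intg continuous_on_mult continuous_on_step continuous_intros smooth_continuous smooth_intros \<rho> F) auto
      show "(\<lambda>x. \<bar>dvg F x\<bar>) integrable_on \<Omega>"
        by (intro intg continuous_on_rabs smooth_continuous smooth_dvg F)
      show "norm (step (- \<rho> x / e n) * dvg F x) \<le> \<bar>dvg F x\<bar>" for n x
        using step_bounds(1,2)[of "- \<rho> x / e n"] by (simp add: abs_mult mult_left_le_one_le)
      fix x assume "x \<in> \<Omega>"
      then have neg: "\<rho> x < 0" using \<Omega>(3) by auto
      \<comment> \<open>From this index on \<open>e n\<close> is at most \<open>- \<rho> x\<close>,
        so the cut-off at \<open>x\<close> has already reached the value 1.\<close>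
      obtain N where N: "h / (- \<rho> x) \<le> real N"
        using real_arch_simple by blast
      have "step (- \<rho> x / e n) = 1" if "n \<ge> N" for n
      proof (rule step_ge_1)
        have "h / (- \<rho> x) \<le> real (Suc n)" using N that by simp
        then have "h \<le> real (Suc n) * (- \<rho> x)"
          using neg by (subst (asm) pos_divide_le_eq) auto
        then show "1 \<le> - \<rho> x / e n"
          using h(1) by (simp add: e_def field_simps)
      qed
      then have "\<forall>\<^sub>F n in sequentially. step (- \<rho> x / e n) * dvg F x = dvg F x"
        unfolding eventually_sequentially by (intro exI[of _ N]) simp
      then show "(\<lambda>n. step (- \<rho> x / e n) * dvg F x) \<longlonglongrightarrow> dvg F x"
        by (rule tendsto_eventually)
    qed
    ultimately show ?thesis
      using LIMSEQ_le_const2[OF tendsto_rabs] by blast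
  qed
  have "\<bar>integral \<Omega> (dvg F)\<bar> \<le> 0"
  proof (rule field_le_epsilon)
    fix e :: real assume "e > 0"
    \<comment> \<open>The denominator is \<open>C + 1\<close> because \<open>C\<close> may be
      zero.\<close>
    then have "\<bar>integral \<Omega> (dvg F)\<bar> \<le> e / (C + 1) * C"
      using C by (intro bound) auto
    also have "\<dots> \<le> e"
      using C \<open>e > 0\<close> by (simp add: field_simps)
    finally show "\<bar>integral \<Omega> (dvg F)\<bar> \<le> 0 + e" by simp
  qed
  then show ?thesis by simp
qed

subsection \<open>Energy identities\<close>

lemma continuous_eq_on_closure:
  fixes f g :: "'a::topological_space \<Rightarrow> 'b::t2_space"
  assumes "continuous_on UNIV f" "continuous_on UNIV g" "\<And>x. x \<in> S \<Longrightarrow> f x = g x" "x \<in> closure S"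
  shows "f x = g x"
proof -
  have "closed {x. f x = g x}"
    by (intro closed_Collect_eq assms(1,2))
  then have "closure S \<subseteq> {x. f x = g x}"
    using assms(3) by (intro closure_minimal) auto
  then show ?thesis using assms(4) by auto
qed

text \<open>By monotonicity the integral also vanishes over a closed box around \<open>x\<close>,
  where continuity forces the function to be zero.\<close>

lemma integral_eq_0_nonneg_open:
  fixes f :: "'a::euclidean_space \<Rightarrow> real"
  assumes \<Omega>: "bounded \<Omega>" "open \<Omega>" and f: "continuous_on UNIV f"
    and nn: "\<And>x. 0 \<le> f x" and int: "integral \<Omega> f = 0" and x: "x \<in> \<Omega>"
  shows "f x = 0"
proof -
  obtain a b where ab: "cbox a b \<subseteq> \<Omega>" "x \<in> box a b"
    by (rule open_contains_cbox[OF \<Omega>(2) x])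
  have cont: "continuous_on (cbox a b) f"
    by (rule continuous_on_subset[OF f]) simp
  then have int': "f integrable_on cbox a b"
    by (rule integrable_continuous)
  then have "integral (cbox a b) f \<le> integral \<Omega> f"
    using continuous_integrable_bounded_open[OF \<Omega> f] ab(1) nn by (intro integral_subset_le) auto
  moreover have "0 \<le> integral (cbox a b) f"
    by (rule integral_nonneg[OF int' nn])
  ultimately have "integral (cbox a b) f = 0"
    using int by simp
  then have "\<forall>x\<in>cbox a b. f x = 0"
    using integral_cbox_eq_0_iff[OF cont] ab(2) nn by blast
  then show ?thesis
    using ab(2) box_subset_cbox by blast
qed

section \<open>Calculus rules for the divergence\<close>

lemma dvg_cong_open: "open S \<Longrightarrow> x \<in> S \<Longrightarrow> (\<And>y. y \<in> S \<Longrightarrow> v y = w y) \<Longrightarrow> dvg v x = dvg w x"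
  unfolding dvg_def by (intro sum.cong refl pd_cong_open) auto

lemma dvg_add:
  assumes "smooth_on UNIV v" "smooth_on UNIV w"
  shows "dvg (\<lambda>y. v y + w y) x = dvg v x + dvg w x"
  by (simp add: dvg_def pd_add smooth_differentiable smooth_nth assms sum.distrib)

lemma dvg_scaleR:
  assumes "smooth_on UNIV a" "smooth_on UNIV v"
  shows "dvg (\<lambda>y. a y *\<^sub>R v y) x = a x * dvg v x + grad a x \<bullet> v x"
  by (simp add: dvg_def pd_bilinear[OF bounded_bilinear_mult] smooth_differentiable smooth_nth assms
      sum.distrib sum_distrib_left inner_vec_def)

lemma grad_const [simp]: "grad (\<lambda>x. c) = (\<lambda>x. 0)"
  by (simp add: fun_eq_iff vec_eq_iff)

lemma dvg_cmult:
  assumes "smooth_on UNIV v"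
  shows "dvg (\<lambda>y. c *\<^sub>R v y) x = c * dvg v x"
  using dvg_scaleR[OF smooth_const assms, of c x] by simp

lemma dvg_diff:
  assumes "smooth_on UNIV v" "smooth_on UNIV w"
  shows "dvg (\<lambda>y. v y - w y) x = dvg v x - dvg w x"
  using dvg_add[OF assms(1) smooth_scaleR[OF smooth_const[of "-1"] assms(2)], of x]
    dvg_cmult[OF assms(2), of "-1" x] by simp

lemma dvg_sum:
  assumes "\<And>i. i \<in> I \<Longrightarrow> smooth_on UNIV (v i)"
  shows "dvg (\<lambda>y. \<Sum>i\<in>I. v i y) x = (\<Sum>i\<in>I. dvg (v i) x)"
proof -
  have "dvg (\<lambda>y. \<Sum>i\<in>I. v i y) x = (\<Sum>j\<in>UNIV. \<Sum>i\<in>I. pd j (\<lambda>y. v i y $ j) x)"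
    unfolding dvg_def
    by (simp add: pd_sum smooth_differentiable smooth_nth assms)
  also have "\<dots> = (\<Sum>i\<in>I. dvg (v i) x)"
    unfolding dvg_def by (rule sum.swap)
  finally show ?thesis .
qed

lemma dvg_ident: "dvg (\<lambda>x::real^'n::finite. x) x = real CARD('n)"
  by (simp add: dvg_def pd_nth[where v="\<lambda>x. x"] smooth_differentiable[OF smooth_ident])

section \<open>Green's identity and its consequences\<close>

lemma tangential_iff_normal:
  assumes "smooth_domain \<Omega> \<rho>" "x \<in> frontier \<Omega>"
  shows "grad \<rho> x \<bullet> v = 0 \<longleftrightarrow> normal \<rho> x \<bullet> v = 0"
  using assms smooth_domain_frontier[OF assms(1)] by (auto simp: normal_def smooth_domain_def)

text \<open>The field \<open>a y *\<^sub>R v y\<close> is tangential as soon as one of the two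
  factors allows it at each boundary point. The disjunction serves Dirichlet conditions on
  \<open>a\<close> and no-flux conditions on \<open>v\<close> alike.\<close>

lemma green_tangential:
  assumes dom: "smooth_domain \<Omega> \<rho>" and a: "smooth_on UNIV a" and v: "smooth_on UNIV v"
    and bc: "\<And>x. x \<in> frontier \<Omega> \<Longrightarrow> a x = 0 \<or> normal \<rho> x \<bullet> v x = 0"
  shows "integral \<Omega> (\<lambda>x. grad a x \<bullet> v x) = - integral \<Omega> (\<lambda>x. a x * dvg v x)"
proof -
  have \<Omega>: "bounded \<Omega>" "open \<Omega>"
    using dom by (auto simp: smooth_domain_def)
  have "integral \<Omega> (dvg (\<lambda>y. a y *\<^sub>R v y)) = 0"
    using bc by (intro integral_dvg_tangential[OF dom smooth_scaleR[OF a v]])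
      (auto simp: tangential_iff_normal[OF dom])
  moreover have "dvg (\<lambda>y. a y *\<^sub>R v y) = (\<lambda>x. a x * dvg v x + grad a x \<bullet> v x)"
    using dvg_scaleR[OF a v] by blast
  moreover have "(\<lambda>x. a x * dvg v x) integrable_on \<Omega>" "(\<lambda>x. grad a x \<bullet> v x) integrable_on \<Omega>"
    by (intro continuous_integrable_bounded_open \<Omega> smooth_continuous smooth_intros a v)+
  ultimately show ?thesis
    by (simp add: integral_add)
qed

text \<open>Applies Green's identity to \<open>f\<^sup>2\<close> and the identity field, whose divergence is a positive
  constant; connectedness of the domain is not needed.\<close>

lemma zero_if_grad_zero:
  fixes f :: "real^'n::finite \<Rightarrow> real"
  assumes dom: "smooth_domain \<Omega> \<rho>" and f: "smooth_on UNIV f"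
    and bc: "\<And>x. x \<in> frontier \<Omega> \<Longrightarrow> f x = 0" and gr: "\<And>x. x \<in> \<Omega> \<Longrightarrow> grad f x = 0"
    and x: "x \<in> \<Omega>"
  shows "f x = 0"
proof -
  have \<Omega>: "bounded \<Omega>" "open \<Omega>"
    using dom by (auto simp: smooth_domain_def)
  have "pd j (\<lambda>y. f y * f y) x = 0" if "x \<in> \<Omega>" for j x
    using gr[OF that] pd_bilinear[OF bounded_bilinear_mult smooth_differentiable[OF f] smooth_differentiable[OF f]]
    by (metis add.right_neutral grad_nth mult_zero_left mult_zero_right zero_index)
  then have "grad (\<lambda>y. f y * f y) x = 0" if "x \<in> \<Omega>" for x
    using that by (simp add: vec_eq_iff)
  then have "integral \<Omega> (\<lambda>x. grad (\<lambda>y. f y * f y) x \<bullet> x) = integral \<Omega> (\<lambda>x. 0)"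
    by (intro integral_cong) simp
  moreover have "integral \<Omega> (\<lambda>x. grad (\<lambda>y. f y * f y) x \<bullet> x) = - integral \<Omega> (\<lambda>x. (f x * f x) * dvg (\<lambda>x. x) x)"
    using bc by (intro green_tangential[OF dom] smooth_intros f) auto
  ultimately have "integral \<Omega> (\<lambda>x. f x * f x) = 0"
    by (simp add: dvg_ident)
  then have "f x * f x = 0"
    using integral_eq_0_nonneg_open[OF \<Omega> _ _ _ x, of "\<lambda>x. f x * f x"] smooth_continuous[OF smooth_mult[OF f f]]
    by simp
  then show ?thesis by simp
qed

lemma dirichlet_energy_zero:
  assumes dom: "smooth_domain \<Omega> \<rho>" and f: "smooth_on UNIV f"
    and int: "integral \<Omega> (\<lambda>x. grad f x \<bullet> grad f x) = 0" and x: "x \<in> \<Omega>"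
  shows "grad f x = 0"
proof -
  have "bounded \<Omega>" "open \<Omega>"
    using dom unfolding smooth_domain_def by blast+
  then have "grad f x \<bullet> grad f x = 0"
    by (rule integral_eq_0_nonneg_open)
      (use int x in \<open>auto intro!: smooth_continuous smooth_inner smooth_grad f\<close>)
  then show ?thesis by simp
qed

text \<open>The potential removed by the projection solves a homogeneous Neumann problem. Green's
  identity for it and its own gradient makes the Dirichlet energy zero, so nothing is
  removed.\<close>

lemma leray_fixes_tangential:
  assumes dom: "smooth_domain \<Omega> \<rho>" and L: "leray \<Omega> (normal \<rho>) v u"
    and div: "\<And>x. x \<in> \<Omega> \<Longrightarrow> dvg v x = 0" and bc: "\<And>x. x \<in> frontier \<Omega> \<Longrightarrow> normal \<rho> x \<bullet> v x = 0"
    and x: "x \<in> \<Omega>"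
  shows "u x = v x"
proof -
  obtain \<phi> where \<phi>: "smooth_on UNIV \<phi>" "\<And>x. x \<in> \<Omega> \<Longrightarrow> lap \<phi> x = dvg v x"
    "\<And>x. x \<in> frontier \<Omega> \<Longrightarrow> normal \<rho> x \<bullet> grad \<phi> x = normal \<rho> x \<bullet> v x"
    "\<And>x. x \<in> \<Omega> \<Longrightarrow> u x = v x - grad \<phi> x"
    using L unfolding leray_def by blast
  have "integral \<Omega> (\<lambda>x. grad \<phi> x \<bullet> grad \<phi> x) = - integral \<Omega> (\<lambda>x. \<phi> x * dvg (grad \<phi>) x)"
    using \<phi>(3) bc by (intro green_tangential[OF dom] smooth_intros \<phi>(1)) auto
  also have "integral \<Omega> (\<lambda>x. \<phi> x * dvg (grad \<phi>) x) = integral \<Omega> (\<lambda>x. 0)"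
    by (intro integral_cong) (simp add: dvg_grad \<phi>(2) div)
  finally have "grad \<phi> x = 0"
    by (intro dirichlet_energy_zero[OF dom \<phi>(1) _ x]) simp
  then show ?thesis using \<phi>(4)[OF x] by simp
qed

text \<open>Green's identity is used for each component and its gradient; the Dirichlet condition
  removes the boundary term.\<close>

lemma integral_lap_inner:
  assumes dom: "smooth_domain \<Omega> \<rho>" and v: "smooth_on UNIV v"
    and bc: "\<And>x. x \<in> frontier \<Omega> \<Longrightarrow> v x = 0"
  shows "integral \<Omega> (\<lambda>x. lap v x \<bullet> v x) = - gradL2sq \<Omega> v"
proof -
  have \<Omega>: "bounded \<Omega>" "open \<Omega>"
    using dom by (auto simp: smooth_domain_def)
  note intg = continuous_integrable_bounded_open[OF \<Omega>] smooth_continuous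
  have "integral \<Omega> (\<lambda>x. lap v x \<bullet> v x) = integral \<Omega> (\<lambda>x. \<Sum>c\<in>UNIV. v x $ c * dvg (grad (\<lambda>y. v y $ c)) x)"
    by (simp add: inner_vec_def dvg_grad lap_nth[OF v] mult.commute)
  also have "\<dots> = (\<Sum>c\<in>UNIV. integral \<Omega> (\<lambda>x. v x $ c * dvg (grad (\<lambda>y. v y $ c)) x))"
    by (intro integral_sum intg smooth_intros v) auto
  also have "\<dots> = (\<Sum>c\<in>UNIV. - integral \<Omega> (\<lambda>x. grad (\<lambda>y. v y $ c) x \<bullet> grad (\<lambda>y. v y $ c) x))"
    using bc by (intro sum.cong refl, subst green_tangential[OF dom]) (auto intro!: smooth_nth smooth_grad v)
  also have "\<dots> = - integral \<Omega> (\<lambda>x. \<Sum>c\<in>UNIV. grad (\<lambda>y. v y $ c) x \<bullet> grad (\<lambda>y. v y $ c) x)"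
    unfolding sum_negf
    by (subst integral_sum) (auto intro!: intg smooth_inner smooth_grad smooth_nth v)
  \<comment> \<open>Regroups the squared partial derivatives from components to directions, the
    order in which \<open>gradL2sq\<close> sums them.\<close>
  also have "(\<lambda>x. \<Sum>c\<in>UNIV. grad (\<lambda>y. v y $ c) x \<bullet> grad (\<lambda>y. v y $ c) x) = (\<lambda>x. \<Sum>j\<in>UNIV. (norm (pd j v x))\<^sup>2)"
    by (rule ext, simp add: inner_vec_def power2_norm_eq_inner pd_nth smooth_differentiable v) (rule sum.swap)
  also have "integral \<Omega> \<dots> = gradL2sq \<Omega> v"
    unfolding gradL2sq_def power2_norm_eq_inner
    by (intro integral_sum intg smooth_intros v) auto
  finally show ?thesis .
qed

subsection \<open>Algebraically stable Runge-Kutta steps\<close>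

text \<open>The scalar quadratic form is applied to each coordinate in an orthonormal basis and
  summed. The two transposed halves of the stability matrix contribute equally, whence the factor
  2.\<close>

lemma alg_stable_inner:
  fixes p :: "nat \<Rightarrow> 'a::euclidean_space"
  assumes "alg_stable s A b"
  shows "0 \<le> 2 * (\<Sum>i=1..s. \<Sum>j=1..s. b i * A i j * (p i \<bullet> p j)) - (\<Sum>i=1..s. \<Sum>j=1..s. b i * b j * (p i \<bullet> p j))"
proof -
  let ?m = "\<lambda>i j. b i * A i j + b j * A j i - b i * b j"
  have st: "0 \<le> (\<Sum>i=1..s. \<Sum>j=1..s. ?m i j * \<xi> i * \<xi> j)" for \<xi>
    using assms unfolding alg_stable_def by blast
  have "0 \<le> (\<Sum>e\<in>Basis. \<Sum>i=1..s. \<Sum>j=1..s. ?m i j * (p i \<bullet> e) * (p j \<bullet> e))"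
    by (rule sum_nonneg) (rule st)
  also have "\<dots> = (\<Sum>i=1..s. \<Sum>j=1..s. \<Sum>e\<in>Basis. ?m i j * (p i \<bullet> e) * (p j \<bullet> e))"
    by (subst sum.swap, intro sum.cong refl, rule sum.swap)
  also have "\<dots> = (\<Sum>i=1..s. \<Sum>j=1..s. ?m i j * (p i \<bullet> p j))"
    by (subst euclidean_inner) (simp add: sum_distrib_left mult.assoc)
  also have "\<dots> = (\<Sum>i=1..s. \<Sum>j=1..s. b i * A i j * (p i \<bullet> p j))
      + (\<Sum>i=1..s. \<Sum>j=1..s. b j * A j i * (p j \<bullet> p i))
      - (\<Sum>i=1..s. \<Sum>j=1..s. b i * b j * (p i \<bullet> p j))"
    by (simp add: algebra_simps sum.distrib sum_subtractf inner_commute)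
  also have "(\<Sum>i=1..s. \<Sum>j=1..s. b j * A j i * (p j \<bullet> p i)) = (\<Sum>i=1..s. \<Sum>j=1..s. b i * A i j * (p i \<bullet> p j))"
    by (rule sum.swap)
  finally show ?thesis by simp
qed

text \<open>Stability bounds the form with coefficients \<open>b i * A i j\<close> below by half the
  square of the sum of the \<open>b i * p i\<close>. The lemma is meant for stage equations with
  starting value zero.\<close>

lemma alg_stable_monotone:
  fixes y p :: "nat \<Rightarrow> real"
  assumes st: "alg_stable s A b" and k: "0 \<le> k"
    and y: "\<And>i. i \<in> {1..s} \<Longrightarrow> y i = k * (\<Sum>j=1..s. A i j * p j)"
  shows "0 \<le> (\<Sum>i=1..s. b i * (y i * p i))"
proof -
  have "0 \<le> (\<Sum>i=1..s. b i * p i)\<^sup>2" by simp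
  also have "\<dots> = (\<Sum>i=1..s. \<Sum>j=1..s. b i * b j * (p i \<bullet> p j))"
    by (simp add: power2_eq_square sum_product algebra_simps)
  finally have "0 \<le> (\<Sum>i=1..s. \<Sum>j=1..s. b i * A i j * (p i \<bullet> p j))"
    using alg_stable_inner[OF st, of p] by linarith
  then have "0 \<le> k * (\<Sum>i=1..s. \<Sum>j=1..s. b i * A i j * (p i \<bullet> p j))"
    using k by simp
  also have "\<dots> = (\<Sum>i=1..s. b i * (y i * p i))"
    by (simp add: y sum_distrib_left sum_distrib_right mult_ac)
  finally show ?thesis .
qed

text \<open>Expanding both squares, the right side minus the left side is exactly
  \<open>k\<^sup>2\<close> times the quadratic form of the stability matrix.\<close>

lemma alg_stable_energy:
  fixes p y :: "nat \<Rightarrow> 'a::euclidean_space"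
  assumes st: "alg_stable s A b"
    and y: "\<And>i. i \<in> {1..s} \<Longrightarrow> y i = y0 + k *\<^sub>R (\<Sum>j=1..s. A i j *\<^sub>R p j)"
    and y1: "y1 = y0 + k *\<^sub>R (\<Sum>i=1..s. b i *\<^sub>R p i)"
  shows "y1 \<bullet> y1 - y0 \<bullet> y0 \<le> 2 * k * (\<Sum>i=1..s. b i * (y i \<bullet> p i))"
proof -
  define T where "T = (\<Sum>i=1..s. \<Sum>j=1..s. b i * A i j * (p i \<bullet> p j))"
  define B where "B = (\<Sum>i=1..s. \<Sum>j=1..s. b i * b j * (p i \<bullet> p j))"
  define L where "L = (\<Sum>i=1..s. b i * (y0 \<bullet> p i))"
  have "0 \<le> k\<^sup>2 * (2 * T - B)"
    using alg_stable_inner[OF st, of p] by (simp add: T_def B_def)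
  moreover have "(\<Sum>i=1..s. b i * (y i \<bullet> p i)) = L + k * T"
    by (simp add: y L_def T_def inner_add_left inner_sum_left inner_sum_right sum.distrib
        sum_distrib_left inner_commute algebra_simps)
  moreover have "y0 \<bullet> (\<Sum>i=1..s. b i *\<^sub>R p i) = L"
    by (simp add: L_def inner_sum_right)
  moreover have "(\<Sum>i=1..s. b i *\<^sub>R p i) \<bullet> (\<Sum>i=1..s. b i *\<^sub>R p i) = B"
    by (simp add: B_def inner_sum_left inner_sum_right sum_distrib_left)
      (intro sum.cong refl, simp add: inner_commute mult_ac)
  ultimately show ?thesis
    by (simp add: y1 inner_add_left inner_add_right inner_commute power2_eq_square algebra_simps)
qed

subsection \<open>Energy decay of the GePUP-ES-RK scheme\<close>

theorem theorem10:
  fixes \<Omega> :: "(real^'n::finite) set" and \<rho> :: "real^'n \<Rightarrow> real"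
    and s :: nat and A :: "nat \<Rightarrow> nat \<Rightarrow> real" and b :: "nat \<Rightarrow> real"
    and \<nu> lam k :: real
    and w u :: "nat \<Rightarrow> real^'n \<Rightarrow> real^'n" and r :: "nat \<Rightarrow> real"
    and W U Ut G Rho :: "nat \<Rightarrow> nat \<Rightarrow> real^'n \<Rightarrow> real^'n"
    and Q :: "nat \<Rightarrow> nat \<Rightarrow> real^'n \<Rightarrow> real"
    and R :: "nat \<Rightarrow> nat \<Rightarrow> real"
  assumes dom: "smooth_domain \<Omega> \<rho>"
    and nu: "\<nu> > 0" and lam_nn: "lam \<ge> 0" and kpos: "k > 0" and s1: "s \<ge> 1"
    and stab: "alg_stable s A b"
    and sm_w: "\<forall>n. smooth_on UNIV (w n)" and sm_u: "\<forall>n. smooth_on UNIV (u n)"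
    and sm_W: "\<forall>n i. smooth_on UNIV (W n i)" and sm_U: "\<forall>n i. smooth_on UNIV (U n i)"
    and sm_Ut: "\<forall>n i. smooth_on UNIV (Ut n i)" and sm_G: "\<forall>n i. smooth_on UNIV (G n i)"
    and sm_Q: "\<forall>n i. smooth_on UNIV (Q n i)"
    and cons: "\<forall>n i. \<exists>\<psi>. smooth_on UNIV \<psi> \<and> (\<forall>x\<in>\<Omega>. G n i x = grad \<psi> x)"
    and init_w: "\<forall>x\<in>closure \<Omega>. w 0 x = u 0 x"
    and init_div: "\<forall>x\<in>\<Omega>. dvg (u 0) x = 0"
    and init_bc: "\<forall>x\<in>frontier \<Omega>. u 0 x = 0"
    and q_eq: "\<forall>n. \<forall>i\<in>{1..s}. \<forall>x\<in>\<Omega>.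
       lap (Q n i) x = dvg (\<lambda>y. G n i y - R n i *\<^sub>R conv (Ut n i) (Ut n i) y) x"
    and q_bc: "\<forall>n. \<forall>i\<in>{1..s}. \<forall>x\<in>frontier \<Omega>.
       normal \<rho> x \<bullet> grad (Q n i) x =
         normal \<rho> x \<bullet> (G n i x - R n i *\<^sub>R conv (Ut n i) (Ut n i) x + \<nu> *\<^sub>R lap (W n i) x)
         + lam * (normal \<rho> x \<bullet> W n i x)"
    and rho_def: "\<forall>n. \<forall>i\<in>{1..s}. \<forall>x.
       Rho n i x = G n i x - R n i *\<^sub>R conv (Ut n i) (Ut n i) x - grad (Q n i) x
                   + \<nu> *\<^sub>R lap (W n i) x"
    and w_stage: "\<forall>n. \<forall>i\<in>{1..s}. \<forall>x\<in>\<Omega>.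
       W n i x = w n x + k *\<^sub>R (\<Sum>j=1..s. A i j *\<^sub>R Rho n j x)"
    and w_bc: "\<forall>n. \<forall>i\<in>{1..s}. \<forall>x\<in>frontier \<Omega>.
       (\<forall>\<tau>. \<tau> \<bullet> normal \<rho> x = 0 \<longrightarrow> W n i x \<bullet> \<tau> = 0) \<and> dvg (W n i) x = 0"
    and r_stage: "\<forall>n. \<forall>i\<in>{1..s}.
       R n i = r n + k * (\<Sum>j=1..s. A i j * Icv \<Omega> (Ut n j) (U n j))"
    and u_stage: "\<forall>n. \<forall>i\<in>{1..s}. leray \<Omega> (normal \<rho>) (W n i) (U n i)"
    and w_step: "\<forall>n. \<forall>x\<in>\<Omega>. w (Suc n) x = w n x + k *\<^sub>R (\<Sum>i=1..s. b i *\<^sub>R Rho n i x)"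
    and r_step: "\<forall>n. r (Suc n) = r n + k * (\<Sum>i=1..s. b i * Icv \<Omega> (Ut n i) (U n i))"
    and u_step: "\<forall>n. leray \<Omega> (normal \<rho>) (w (Suc n)) (u (Suc n))"
  shows "\<forall>n. (L2sq \<Omega> (u (Suc n)) + (r (Suc n))\<^sup>2) / 2 - (L2sq \<Omega> (u n) + (r n)\<^sup>2) / 2
           \<le> - k * \<nu> * (\<Sum>i=1..s. b i * gradL2sq \<Omega> (U n i))"
proof
  have \<Omega>: "bounded \<Omega>" "open \<Omega>"
    using dom unfolding smooth_domain_def by blast+
  note intg = continuous_integrable_bounded_open[OF \<Omega>] smooth_continuous
  note sm = sm_w[rule_format] sm_u[rule_format] sm_W[rule_format] sm_U[rule_format]
    sm_Ut[rule_format] sm_G[rule_format] sm_Q[rule_format]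
  have b_nn: "0 \<le> b i" if "i \<in> {1..s}" for i
    using stab that unfolding alg_stable_def by blast
  have Rho_eq: "Rho n i = (\<lambda>x. G n i x - R n i *\<^sub>R conv (Ut n i) (Ut n i) x - grad (Q n i) x
      + \<nu> *\<^sub>R lap (W n i) x)" if "i \<in> {1..s}" for n i
    using rho_def that by blast
  have sm_Rho: "smooth_on UNIV (Rho n i)" if "i \<in> {1..s}" for n i
    unfolding Rho_eq[OF that] by (intro smooth_intros sm)
  \<comment> \<open>The equation for \<open>Q\<close> cancels the divergence of force and
    convection, leaving only the viscous part.\<close>
  have dvg_Rho: "dvg (Rho n i) x = \<nu> * lap (dvg (W n i)) x" if "i \<in> {1..s}" "x \<in> \<Omega>" for n i x
  proof -
    let ?F = "\<lambda>y. G n i y - R n i *\<^sub>R conv (Ut n i) (Ut n i) y"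
    have F: "smooth_on UNIV ?F" by (intro smooth_intros sm)
    have "dvg (Rho n i) x = dvg (\<lambda>y. ?F y - grad (Q n i) y) x + dvg (\<lambda>y. \<nu> *\<^sub>R lap (W n i) y) x"
      unfolding Rho_eq[OF that(1)] by (intro dvg_add smooth_minus F smooth_intros sm)
    also have "dvg (\<lambda>y. ?F y - grad (Q n i) y) x = dvg ?F x - dvg (grad (Q n i)) x"
      by (intro dvg_diff F smooth_grad sm)
    also have "\<dots> = 0"
      using q_eq that by (simp add: dvg_grad)
    also have "dvg (\<lambda>y. \<nu> *\<^sub>R lap (W n i) y) x = \<nu> * lap (dvg (W n i)) x"
      by (simp add: dvg_cmult smooth_lap sm dvg_lap)
    finally show ?thesis by simp
  qed
  \<comment> \<open>The boundary condition for \<open>Q\<close> cancels every normal component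
    except the damping term.\<close>
  have normal_Rho: "normal \<rho> x \<bullet> Rho n i x = - lam * (normal \<rho> x \<bullet> W n i x)"
    if "i \<in> {1..s}" "x \<in> frontier \<Omega>" for n i x
    using q_bc that unfolding Rho_eq[OF that(1)] by (simp add: inner_add_right inner_diff_right)
  have fr_cl: "x \<in> closure \<Omega>" if "x \<in> frontier \<Omega>" for x
    using that by (simp add: frontier_def)
  \<comment> \<open>The weights \<open>c\<close> stay arbitrary so that these facts cover the
    stages, with a row of \<open>A\<close>, and the step, with \<open>b\<close>.\<close>
  have sm_update: "smooth_on UNIV (\<lambda>x. w n x + k *\<^sub>R (\<Sum>j=1..s. c j *\<^sub>R Rho n j x))" for n c
    by (intro smooth_add smooth_scaleR smooth_sum smooth_const sm sm_Rho)
  have dvg_update: "dvg (\<lambda>x. w n x + k *\<^sub>R (\<Sum>j=1..s. c j *\<^sub>R Rho n j x)) x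
      = dvg (w n) x + k * (\<Sum>j=1..s. c j * (\<nu> * lap (dvg (W n j)) x))" if "x \<in> \<Omega>" for n c x
  proof -
    have S: "smooth_on UNIV (\<lambda>x. c j *\<^sub>R Rho n j x)" if "j \<in> {1..s}" for j
      by (intro smooth_scaleR smooth_const sm_Rho that)
    have SS: "smooth_on UNIV (\<lambda>x. \<Sum>j=1..s. c j *\<^sub>R Rho n j x)"
      by (rule smooth_sum[OF S])
    have "dvg (\<lambda>x. w n x + k *\<^sub>R (\<Sum>j=1..s. c j *\<^sub>R Rho n j x)) x
      = dvg (w n) x + k * dvg (\<lambda>x. \<Sum>j=1..s. c j *\<^sub>R Rho n j x) x"
      using SS by (subst dvg_add) (auto intro!: smooth_scaleR smooth_const sm dvg_cmult)
    also have "dvg (\<lambda>x. \<Sum>j=1..s. c j *\<^sub>R Rho n j x) x = (\<Sum>j=1..s. dvg (\<lambda>x. c j *\<^sub>R Rho n j x) x)"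
      by (rule dvg_sum[OF S])
    also have "\<dots> = (\<Sum>j=1..s. c j * (\<nu> * lap (dvg (W n j)) x))"
      by (intro sum.cong refl) (simp add: dvg_cmult sm_Rho dvg_Rho that)
    finally show ?thesis .
  qed
  have normal_update: "normal \<rho> x \<bullet> (w n x + k *\<^sub>R (\<Sum>j=1..s. c j *\<^sub>R Rho n j x))
      = normal \<rho> x \<bullet> w n x - k * lam * (\<Sum>j=1..s. c j * (normal \<rho> x \<bullet> W n j x))"
    if "x \<in> frontier \<Omega>" for n c x
  proof -
    have "normal \<rho> x \<bullet> (\<Sum>j=1..s. c j *\<^sub>R Rho n j x) = (\<Sum>j=1..s. - lam * (c j * (normal \<rho> x \<bullet> W n j x)))"
      unfolding inner_sum_right by (intro sum.cong refl) (simp add: normal_Rho that)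
    then show ?thesis
      by (simp add: inner_add_right sum_distrib_left sum_negf mult_ac)
  qed
  define Inv where "Inv n \<longleftrightarrow> (\<forall>x\<in>\<Omega>. dvg (w n) x = 0) \<and>
    (\<forall>x\<in>frontier \<Omega>. normal \<rho> x \<bullet> w n x = 0) \<and> (\<forall>x\<in>\<Omega>. u n x = w n x)" for n
  \<comment> \<open>The factor \<open>b i\<close> remains because the weighted energy sum gives no
    control over a stage of weight zero.\<close>
  have stage_dvg: "b i * dvg (W n i) x = 0" if inv: "Inv n" and i: "i \<in> {1..s}" and x: "x \<in> \<Omega>" for n i x
  proof -
    define D where "D i = dvg (W n i)" for i
    have D: "smooth_on UNIV (D i)" for i
      unfolding D_def by (intro smooth_dvg sm)
    define e where "e i = integral \<Omega> (\<lambda>x. grad (D i) x \<bullet> grad (D i) x)" for i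
    have e_nn: "0 \<le> e i" for i
      unfolding e_def by (intro integral_nonneg intg smooth_intros D) auto
    have D_bc: "D i x = 0" if "i \<in> {1..s}" "x \<in> frontier \<Omega>" for i x
      using w_bc that unfolding D_def by blast
    have D_lap: "integral \<Omega> (\<lambda>x. D i x * lap (D i) x) = - e i" if "i \<in> {1..s}" for i
      using green_tangential[OF dom D smooth_grad[OF D], of i i] D_bc[OF that]
      by (simp add: e_def dvg_grad)
    have D_stage: "D i x = k * (\<Sum>j=1..s. A i j * (\<nu> * lap (D j) x))"
      if "i \<in> {1..s}" "x \<in> \<Omega>" for i x
    proof -
      have "D i x = dvg (\<lambda>x. w n x + k *\<^sub>R (\<Sum>j=1..s. A i j *\<^sub>R Rho n j x)) x"
        unfolding D_def using w_stage that by (intro dvg_cong_open[OF \<Omega>(2)]) auto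
      then show ?thesis
        using dvg_update[OF that(2)] inv that(2) by (simp add: Inv_def D_def)
    qed
    \<comment> \<open>The integrand is nonnegative pointwise by \<open>alg_stable_monotone\<close>,
      since the invariant makes the starting divergence zero. Integration by parts turns the
      integral into minus \<open>\<nu>\<close> times the weighted energies.\<close>
    have "0 \<le> integral \<Omega> (\<lambda>x. \<Sum>i=1..s. b i * (D i x * (\<nu> * lap (D i) x)))"
    proof (rule integral_nonneg)
      show "(\<lambda>x. \<Sum>i=1..s. b i * (D i x * (\<nu> * lap (D i) x))) integrable_on \<Omega>"
        by (intro intg smooth_intros D)
      show "0 \<le> (\<Sum>i=1..s. b i * (D i x * (\<nu> * lap (D i) x)))" if "x \<in> \<Omega>" for x
        using kpos that
        by (intro alg_stable_monotone[OF stab, where y = "\<lambda>i. D i x" and k = k] D_stage) auto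
    qed
    also have "\<dots> = (\<Sum>i=1..s. integral \<Omega> (\<lambda>x. (b i * \<nu>) * (D i x * lap (D i) x)))"
      by (subst integral_sum) (auto intro!: intg smooth_mult smooth_const smooth_lap D simp: mult_ac)
    also have "\<dots> = - (\<nu> * (\<Sum>i=1..s. b i * e i))"
      by (simp add: D_lap sum_distrib_left sum_negf mult_ac)
    finally have "(\<Sum>i=1..s. b i * e i) \<le> 0"
      using nu by (simp add: mult_le_0_iff)
    then have "(\<Sum>i=1..s. b i * e i) = 0"
      using b_nn e_nn by (intro antisym sum_nonneg) auto
    then have "b i * e i = 0"
      using i b_nn e_nn by (subst (asm) sum_nonneg_eq_0_iff) auto
    then consider "b i = 0" | "e i = 0" by auto
    then have "b i * D i x = 0"
    proof cases
      case 2
      then have "grad (D i) x = 0" if "x \<in> \<Omega>" for x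
        using dirichlet_energy_zero[OF dom D _ that, of i] by (simp add: e_def)
      then show ?thesis
        using zero_if_grad_zero[OF dom D D_bc[OF i] _ x] by simp
    qed simp
    then show ?thesis by (simp add: D_def)
  qed
  have stage_normal: "b i * (normal \<rho> x \<bullet> W n i x) = 0"
    if inv: "Inv n" and i: "i \<in> {1..s}" and x: "x \<in> frontier \<Omega>" for n i x
  proof -
    define N where "N i = normal \<rho> x \<bullet> W n i x" for i
    have N: "N i = k * (\<Sum>j=1..s. A i j * (- lam * N j))" if i: "i \<in> {1..s}" for i
    proof -
      \<comment> \<open>The stage equation is given only inside the domain; continuity of both sides
        carries it to the frontier.\<close>
      have "W n i x = w n x + k *\<^sub>R (\<Sum>j=1..s. A i j *\<^sub>R Rho n j x)"
        by (rule continuous_eq_on_closure[OF smooth_continuous[OF sm_W[rule_format]]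
              smooth_continuous[OF sm_update] _ fr_cl[OF x]])
          (use w_stage i in blast)
      then have "N i = - k * lam * (\<Sum>j=1..s. A i j * N j)"
        using normal_update[OF x] inv x by (simp add: N_def Inv_def)
      then show ?thesis by (simp add: sum_distrib_left sum_negf mult_ac)
    qed
    have "b i * N i = 0"
    \<comment> \<open>Without damping the recursion itself gives \<open>N i = 0\<close>; the
      quadratic form is informative only for positive \<open>lam\<close>.\<close>
    proof (cases "lam = 0")
      case True
      then show ?thesis using N[OF i] by simp
    next
      case False
      have "0 \<le> (\<Sum>i=1..s. b i * (N i * (- lam * N i)))"
        using kpos by (intro alg_stable_monotone[OF stab _ N]) auto
      also have "\<dots> = - lam * (\<Sum>i=1..s. b i * (N i)\<^sup>2)"
        by (simp add: sum_distrib_left power2_eq_square sum_negf mult_ac)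
      finally have "(\<Sum>i=1..s. b i * (N i)\<^sup>2) \<le> 0"
        using False lam_nn by (simp add: mult_le_0_iff)
      then have "(\<Sum>i=1..s. b i * (N i)\<^sup>2) = 0"
        using b_nn by (intro antisym sum_nonneg) auto
      then show ?thesis
        using i b_nn by (subst (asm) sum_nonneg_eq_0_iff) auto
    qed
    then show ?thesis by (simp add: N_def)
  qed
  have inv: "Inv n" for n
  proof (induction n)
    case 0
    have "dvg (w 0) x = 0" if "x \<in> \<Omega>" for x
      using dvg_cong_open[OF \<Omega>(2) that, of "w 0" "u 0"] init_w init_div closure_subset that by fastforce
    then show ?case
      using init_w init_bc fr_cl closure_subset[of \<Omega>] by (auto simp: Inv_def subset_iff)
  next
    case (Suc n)
    have d: "dvg (w (Suc n)) x = 0" if x: "x \<in> \<Omega>" for x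
    proof -
      \<comment> \<open>The weighted divergence vanishes on an open set, hence so do its
        derivatives. Keeping \<open>b i\<close> under the derivative avoids a case split.\<close>
      have "b i * lap (dvg (W n i)) x = 0" if i: "i \<in> {1..s}" for i
      proof -
        have "lap (\<lambda>y. b i *\<^sub>R dvg (W n i) y) x = 0"
        proof -
          have "pd j (\<lambda>y. b i *\<^sub>R dvg (W n i) y) y = 0" if "y \<in> \<Omega>" for j y
            using pd_cong_open[OF \<Omega>(2) that, of "\<lambda>y. b i *\<^sub>R dvg (W n i) y" "\<lambda>y. 0" j] stage_dvg[OF Suc i]
            by simp
          then have "pd j (pd j (\<lambda>y. b i *\<^sub>R dvg (W n i) y)) x = 0" for j
            using pd_cong_open[OF \<Omega>(2) x, of "pd j (\<lambda>y. b i *\<^sub>R dvg (W n i) y)" "\<lambda>y. 0" j] by simp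
          then show ?thesis by (simp add: lap_def)
        qed
        moreover have "pd j (\<lambda>y. b i *\<^sub>R f y) = (\<lambda>y. b i *\<^sub>R pd j f y)" if "smooth_on UNIV f" for j and f :: "real^'n \<Rightarrow> real"
          using pd_linear[OF bounded_linear_scaleR_right smooth_differentiable[OF that]] by blast
        ultimately show ?thesis
          by (simp add: lap_def smooth_pd smooth_dvg sm flip: sum_distrib_left)
      qed
      then have Z: "(\<Sum>j=1..s. b j * (\<nu> * lap (dvg (W n j)) x)) = 0"
        by (intro sum.neutral ballI) (metis mult.left_commute mult_zero_right)
      have "dvg (\<lambda>x. w n x + k *\<^sub>R (\<Sum>j=1..s. b j *\<^sub>R Rho n j x)) x = 0"
        unfolding dvg_update[OF x] Z using Suc x by (simp add: Inv_def)
      then show ?thesis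
        using dvg_cong_open[OF \<Omega>(2) x, of "w (Suc n)"] w_step by simp
    qed
    have nrm: "normal \<rho> x \<bullet> w (Suc n) x = 0" if x: "x \<in> frontier \<Omega>" for x
    proof -
      have "w (Suc n) x = w n x + k *\<^sub>R (\<Sum>j=1..s. b j *\<^sub>R Rho n j x)"
        by (rule continuous_eq_on_closure[OF smooth_continuous[OF sm_w[rule_format]]
              smooth_continuous[OF sm_update] _ fr_cl[OF x]])
          (use w_step in blast)
      then show ?thesis
        using normal_update[OF x, of n b] Suc x stage_normal[OF Suc _ x] by (simp add: Inv_def)
    qed
    show ?case
      using d nrm leray_fixes_tangential[OF dom u_step[rule_format]] by (simp add: Inv_def)
  qed
  fix n
  have stage_energy: "b i * integral \<Omega> (\<lambda>x. W n i x \<bullet> Rho n i x)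
      = b i * (- R n i * Icv \<Omega> (Ut n i) (U n i) - \<nu> * gradL2sq \<Omega> (U n i))" if i: "i \<in> {1..s}" for i
  proof (cases "b i = 0")
    case False
    have d: "dvg (W n i) x = 0" if "x \<in> \<Omega>" for x
      using stage_dvg[OF inv i that, of n] False by simp
    have bc: "W n i x = 0" if "x \<in> frontier \<Omega>" for x
    proof -
      have "W n i x \<bullet> normal \<rho> x = 0"
        using stage_normal[OF inv i that, of n] False by (simp add: inner_commute)
      \<comment> \<open>Having no normal component, the boundary value is itself an admissible
        tangent vector \<open>\<tau>\<close> in \<open>w_bc\<close>.\<close>
      then have "W n i x \<bullet> W n i x = 0"
        using w_bc i that by blast
      then show ?thesis by simp
    qed
    have UW: "U n i x = W n i x" if "x \<in> \<Omega>" for x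
      by (rule leray_fixes_tangential[OF dom u_stage[rule_format, OF i] d _ that]) (simp_all add: bc)
    have orth: "integral \<Omega> (\<lambda>x. grad f x \<bullet> W n i x) = 0" if "smooth_on UNIV f" for f
    proof -
      have "integral \<Omega> (\<lambda>x. f x * dvg (W n i) x) = integral \<Omega> (\<lambda>x. 0)"
        by (intro integral_cong) (simp add: d)
      then show ?thesis
        using green_tangential[OF dom that sm_W[rule_format], of n i] bc by simp
    qed
    obtain \<psi> where \<psi>: "smooth_on UNIV \<psi>" "\<And>x. x \<in> \<Omega> \<Longrightarrow> G n i x = grad \<psi> x"
      using cons by blast
    have Icv_eq: "Icv \<Omega> (Ut n i) (U n i) = integral \<Omega> (\<lambda>x. conv (Ut n i) (Ut n i) x \<bullet> W n i x)"
      unfolding Icv_def by (intro integral_cong) (simp add: UW)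
    \<comment> \<open>\<open>U\<close> and \<open>W\<close> agree only inside the domain, but
      openness is enough for their derivatives to agree there.\<close>
    have "pd j (U n i) x = pd j (W n i) x" if "x \<in> \<Omega>" for j x
      by (rule pd_cong_open[OF \<Omega>(2) that UW])
    then have grad_eq: "gradL2sq \<Omega> (U n i) = gradL2sq \<Omega> (W n i)"
      unfolding gradL2sq_def by (intro sum.cong refl integral_cong) simp
    have "integral \<Omega> (\<lambda>x. W n i x \<bullet> Rho n i x) = integral \<Omega> (\<lambda>x. grad \<psi> x \<bullet> W n i x
        - R n i * (conv (Ut n i) (Ut n i) x \<bullet> W n i x) - grad (Q n i) x \<bullet> W n i x + \<nu> * (lap (W n i) x \<bullet> W n i x))"
      by (intro integral_cong)
        (simp add: Rho_eq[OF i] \<psi>(2) inner_add_right inner_diff_right inner_commute)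
    also have "\<dots> = integral \<Omega> (\<lambda>x. grad \<psi> x \<bullet> W n i x)
        - integral \<Omega> (\<lambda>x. R n i * (conv (Ut n i) (Ut n i) x \<bullet> W n i x))
        - integral \<Omega> (\<lambda>x. grad (Q n i) x \<bullet> W n i x) + integral \<Omega> (\<lambda>x. \<nu> * (lap (W n i) x \<bullet> W n i x))"
    proof -
      have I: "(\<lambda>x. grad \<psi> x \<bullet> W n i x) integrable_on \<Omega>"
        "(\<lambda>x. R n i * (conv (Ut n i) (Ut n i) x \<bullet> W n i x)) integrable_on \<Omega>"
        "(\<lambda>x. grad (Q n i) x \<bullet> W n i x) integrable_on \<Omega>"
        "(\<lambda>x. \<nu> * (lap (W n i) x \<bullet> W n i x)) integrable_on \<Omega>"
        by (intro intg smooth_intros sm \<psi>(1))+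
      note I12 = integrable_diff[OF I(1,2)]
      note I123 = integrable_diff[OF I12 I(3)]
      show ?thesis
        by (simp only: integral_add[OF I123 I(4)] integral_diff[OF I12 I(3)] integral_diff[OF I(1,2)])
    qed
    also have "\<dots> = - R n i * Icv \<Omega> (Ut n i) (U n i) - \<nu> * gradL2sq \<Omega> (U n i)"
      using orth[OF \<psi>(1)] orth[OF sm_Q[rule_format]] integral_lap_inner[OF dom sm_W[rule_format] bc]
      by (simp add: Icv_eq grad_eq)
    finally show ?thesis by simp
  qed simp
  have "L2sq \<Omega> (u (Suc n)) - L2sq \<Omega> (u n)
      = integral \<Omega> (\<lambda>x. u (Suc n) x \<bullet> u (Suc n) x - u n x \<bullet> u n x)"
    unfolding L2sq_def power2_norm_eq_inner
    by (rule integral_diff[symmetric]) (intro intg smooth_intros sm)+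
  also have "\<dots> \<le> integral \<Omega> (\<lambda>x. 2 * k * (\<Sum>i=1..s. b i * (W n i x \<bullet> Rho n i x)))"
  proof (rule integral_le)
    show "(\<lambda>x. u (Suc n) x \<bullet> u (Suc n) x - u n x \<bullet> u n x) integrable_on \<Omega>"
      by (intro intg smooth_intros sm)
    show "(\<lambda>x. 2 * k * (\<Sum>i=1..s. b i * (W n i x \<bullet> Rho n i x))) integrable_on \<Omega>"
      by (intro intg smooth_mult smooth_sum smooth_inner smooth_const sm sm_Rho)
    fix x assume x: "x \<in> \<Omega>"
    show "u (Suc n) x \<bullet> u (Suc n) x - u n x \<bullet> u n x \<le> 2 * k * (\<Sum>i=1..s. b i * (W n i x \<bullet> Rho n i x))"
    \<comment> \<open>At a fixed point \<open>x\<close> the scheme is a Runge-Kutta step in a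
      finite-dimensional space, and the invariant allows it to start at \<open>u n x\<close> and end
      at \<open>u (Suc n) x\<close>.\<close>
    proof (rule alg_stable_energy[OF stab])
      show "W n i x = u n x + k *\<^sub>R (\<Sum>j=1..s. A i j *\<^sub>R Rho n j x)" if "i \<in> {1..s}" for i
        using w_stage that x inv[of n] by (simp add: Inv_def)
      show "u (Suc n) x = u n x + k *\<^sub>R (\<Sum>i=1..s. b i *\<^sub>R Rho n i x)"
        using w_step x inv[of n] inv[of "Suc n"] by (simp add: Inv_def)
    qed
  qed
  also have "\<dots> = 2 * k * (\<Sum>i=1..s. b i * integral \<Omega> (\<lambda>x. W n i x \<bullet> Rho n i x))"
  proof -
    have "integral \<Omega> (\<lambda>x. \<Sum>i=1..s. b i * (W n i x \<bullet> Rho n i x))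
      = (\<Sum>i=1..s. integral \<Omega> (\<lambda>x. b i * (W n i x \<bullet> Rho n i x)))"
      by (intro integral_sum intg smooth_mult smooth_inner smooth_const sm sm_Rho) auto
    then show ?thesis by simp
  qed
  also have "\<dots> = 2 * k * (\<Sum>i=1..s. b i * (- R n i * Icv \<Omega> (Ut n i) (U n i) - \<nu> * gradL2sq \<Omega> (U n i)))"
    by (simp only: stage_energy cong: sum.cong)
  also have "\<dots> = - 2 * k * (\<Sum>i=1..s. b i * (R n i * Icv \<Omega> (Ut n i) (U n i)))
      - 2 * k * \<nu> * (\<Sum>i=1..s. b i * gradL2sq \<Omega> (U n i))"
    by (simp add: sum_distrib_left sum_subtractf sum_negf algebra_simps)
  finally have u_bound: "L2sq \<Omega> (u (Suc n)) - L2sq \<Omega> (u n)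
      \<le> - 2 * k * (\<Sum>i=1..s. b i * (R n i * Icv \<Omega> (Ut n i) (U n i)))
      - 2 * k * \<nu> * (\<Sum>i=1..s. b i * gradL2sq \<Omega> (U n i))" .
  \<comment> \<open>The same estimate for the scalar variable, with the inner product on the reals.
    Its right side is the negative of the convection sum in \<open>u_bound\<close>, so adding the
    two leaves the dissipation.\<close>
  have r_bound: "r (Suc n) \<bullet> r (Suc n) - r n \<bullet> r n
      \<le> 2 * k * (\<Sum>i=1..s. b i * (R n i \<bullet> Icv \<Omega> (Ut n i) (U n i)))"
    using r_stage r_step by (intro alg_stable_energy[OF stab]) auto
  show "(L2sq \<Omega> (u (Suc n)) + (r (Suc n))\<^sup>2) / 2 - (L2sq \<Omega> (u n) + (r n)\<^sup>2) / 2
           \<le> - k * \<nu> * (\<Sum>i=1..s. b i * gradL2sq \<Omega> (U n i))"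
    using u_bound r_bound by (simp add: power2_eq_square field_simps)
qed

end
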